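(* In the setting and notation of the context, let $0\le\gamma<\infty$ and suppose that: (1) (uniform convergence) uniform convergence holds over $\mathcal H$ for the losses $\ell_0$, $\ell$ and $\mathbb I\{\ell\le 0\}$ with rates $\zeta_0(N,\delta)$, $\zeta(N,\delta)$ and $\zeta_I(N,\delta)$; (2) (dual attainment) the unrestricted statistical and empirical dual problems $\sup_{\lambda\in L^1_+(\mathcal D)}g(\lambda)$ and $\sup_{\lambda\in\mathbb R_+^N}\hat g(\lambda)$ have optimal solutions $\lambda^\star$ and $\hat\lambda^\star$. Consider the restricted problems $$D^\star_\gamma=\sup_{\lambda\in\Lambda_\gamma}g(\lambda),\quad \Lambda_\gamma=\{\lambda\in L^1_+(\mathcal D):\|\lambda\|_\infty\le\gamma\},\qquad \hat D^\star_\gamma=\max_{\lambda\in[0,\gamma]^N}\hat g(\lambda).$$ Then optimal solutions $\lambda^\star_\gamma$ and $\hat\lambda^\star_\gamma$ of these two restricted problems exist, and for every $\delta\in(0,1)$ the estimator $\hat f^\star_\theta\in\arg\min_{f\in\mathcal H}\hat L(f,\hat\lambda^\star_\gamma)$ satisfies, with probability at least $1-4\delta$ over the samples, $$|D^\star_\gamma-\hat L(\hat f^\star_\theta,\hat\lambda^\star_\gamma)|\le 2\zeta_0(N,\delta)+\gamma\,\zeta(N,\delta).$$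
   Context: Setting. $\mathcal X,\mathcal Y$ are the input and output spaces, $\mathcal Z=\mathcal X\times\mathcal Y$, $\mathbf z=(\mathbf x,y)$. $\mathcal D_0,\mathcal D$ are probability distributions on $\mathcal Z$. $\mathcal H=\{f_\theta:\theta\in\Theta\subseteq\mathbb R^p\}$ is a class of predictors $f_\theta:\mathcal X\to\mathcal Y$. The objective loss is $\ell_0:\mathcal Y\times\mathcal Y\to[0,B]$; the constraint loss is $\ell=\ell_1-c$ with $\ell_1:\mathcal Y\times\mathcal Y\to[0,B]$ and a threshold $c\in\mathbb R$. Write $\ell(f,\mathbf z)=\ell(f(\mathbf x),y)$, similarly for $\ell_0$. Minima over $\mathcal H$ are assumed attained wherever "min" or "argmin" is written. Samples. $S_0=\{\mathbf z^0_n\}_{n=1}^N$ is i.i.d. from $\mathcal D_0$ and $S=\{\mathbf z_n\}_{n=1}^N$ is i.i.d. from $\mathcal D$ (if $\mathcal D_0=\mathcal D$ one may take $S_0=S$). Uniform convergence. A loss $h$ satisfies uniform convergence over $\mathcal H$ with rate $\zeta_h(N,\delta)\ge 0$ (decreasing in $N$) if, for every distribution $\mathcal Q$ on $\mathcal Z$, with probability at least $1-\delta$ over $N$ i.i.d. samples $\mathbf z_n\sim\mathcal Q$, $\big|\mathbb E_{\mathcal Q}[h(f,\mathbf z)]-\frac1N\sum_n h(f,\mathbf z_n)\big|\le\zeta_h(N,\delta)$ for all $f\in\mathcal H$ simultaneously (the rate may depend on $\mathcal Q$; $\zeta_0$ is used with $\mathcal D_0$, and $\zeta,\zeta_I$ with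 $\mathcal D$). Standing assumption: the rates come from vanishing Rademacher complexity, i.e. $\zeta_h(N,\delta)=2\mathcal R_N(h\circ\mathcal H)+B_h\sqrt{\log(2/\delta)/(2N)}$ with $\mathcal R_N(h\circ\mathcal H)=\frac1N\mathbb E_{S}\mathbb E_\sigma\big[\sup_{f\in\mathcal H}\sum_{n=1}^N\sigma_n h(f,\mathbf z_n)\big]\to0$, $\sigma_n$ i.i.d. uniform on $\{\pm1\}$, and $B_h=B$ for $\ell_0,\ell$ and $B_h=1$ for the indicator. Dual functions. For $\lambda\in L^1_+(\mathcal D)$ (nonnegative $\mathcal D$-integrable functions on $\mathcal Z$), $L(f,\lambda)=\mathbb E_{\mathcal D_0}[\ell_0(f,\mathbf z)]+\mathbb E_{\mathcal D}[\lambda(\mathbf z)\ell(f,\mathbf z)]$ and $g(\lambda)=\min_{f\in\mathcal H}L(f,\lambda)$. For $\lambda\in\mathbb R^N_+$, $\hat L(f,\lambda)=\frac1N\sum_{n=1}^N\ell_0(f,\mathbf z^0_n)+\frac1N\sum_{n=1}^N\lambda_n\ell(f,\mathbf z_n)$ and $\hat g(\lambda)=\min_{f\in\mathcal H}\hat L(f,\lambda)$. $\|\cdot\|_\infty$ is the $L^\infty(\mathcal D)$ norm. *)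

theory Defs
  imports "HOL-Probability.Probability"
begin

text \<open>
  A (pointwise) loss compares a prediction with a label, \<open>l :: 'y \<Rightarrow> 'y \<Rightarrow> real\<close>; evaluated at a
  predictor and a data point it becomes a function \<open>('x \<Rightarrow> 'y) \<Rightarrow> 'x \<times> 'y \<Rightarrow> real\<close>.
\<close>

definition loss_at :: "('y \<Rightarrow> 'y \<Rightarrow> real) \<Rightarrow> ('x \<Rightarrow> 'y) \<Rightarrow> 'x \<times> 'y \<Rightarrow> real" where
  "loss_at l f z = l (f (fst z)) (snd z)"

definition constraint_loss :: "('y \<Rightarrow> 'y \<Rightarrow> real) \<Rightarrow> real \<Rightarrow> 'y \<Rightarrow> 'y \<Rightarrow> real" where
  "constraint_loss l1 c a b = l1 a b - c"

definition indicator_loss :: "('y \<Rightarrow> 'y \<Rightarrow> real) \<Rightarrow> 'y \<Rightarrow> 'y \<Rightarrow> real" where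
  "indicator_loss l a b = (if l a b \<le> 0 then 1 else 0)"

text \<open>
  ``With probability at least \<open>p\<close>'' is read through a measurable event contained in the set of
  good outcomes, because the latter involves all \<open>f\<close> in an arbitrary class \<open>H\<close> simultaneously and
  need not be measurable itself.
\<close>

definition holds_with_prob :: "'w measure \<Rightarrow> real \<Rightarrow> ('w \<Rightarrow> bool) \<Rightarrow> bool" where
  "holds_with_prob M p P \<longleftrightarrow>
     (\<exists>A\<in>sets M. A \<subseteq> {\<omega> \<in> space M. P \<omega>} \<and> p \<le> measure M A)"

definition distributions :: "'z measure \<Rightarrow> 'z measure set" where
  "distributions Z = {Q. prob_space Q \<and> sets Q = sets Z}"

definition iid_sample ::
  "'w measure \<Rightarrow> 'z measure \<Rightarrow> nat \<Rightarrow> (nat \<Rightarrow> 'w \<Rightarrow> 'z) \<Rightarrow> bool" where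
  "iid_sample M Q N S \<longleftrightarrow>
     prob_space.indep_vars M (\<lambda>_. Q) S {..<N} \<and> (\<forall>n<N. distr M Q (S n) = Q)"

text \<open>The rate \<open>\<zeta> Q N \<delta>\<close> may depend on the distribution \<open>Q\<close>.\<close>

definition uniform_convergence ::
  "('x \<times> 'y) measure \<Rightarrow> ('x \<Rightarrow> 'y) set \<Rightarrow> ('y \<Rightarrow> 'y \<Rightarrow> real)
     \<Rightarrow> (('x \<times> 'y) measure \<Rightarrow> nat \<Rightarrow> real \<Rightarrow> real) \<Rightarrow> bool" where
  "uniform_convergence Z H h \<zeta> \<longleftrightarrow>
     (\<forall>Q\<in>distributions Z. \<forall>\<delta>\<in>{0<..<1}.
        (\<forall>N\<ge>1. 0 \<le> \<zeta> Q N \<delta>) \<and>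
        (\<forall>N\<ge>1. \<forall>N'\<ge>N. \<zeta> Q N' \<delta> \<le> \<zeta> Q N \<delta>) \<and>
        (\<forall>N\<ge>1. holds_with_prob (PiM {..<N} (\<lambda>_. Q)) (1 - \<delta>)
           (\<lambda>s. \<forall>f\<in>H. \<bar>(\<integral>z. loss_at h f z \<partial>Q) - (\<Sum>n<N. loss_at h f (s n)) / real N\<bar>
                  \<le> \<zeta> Q N \<delta>)))"

definition rademacher_sup ::
  "('x \<Rightarrow> 'y) set \<Rightarrow> ('y \<Rightarrow> 'y \<Rightarrow> real) \<Rightarrow> nat \<Rightarrow> (nat \<Rightarrow> real) \<Rightarrow> (nat \<Rightarrow> 'x \<times> 'y) \<Rightarrow> real" where
  "rademacher_sup H h N \<sigma> s = (SUP f\<in>H. \<Sum>n<N. \<sigma> n * loss_at h f (s n))"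

text \<open>
  The expectation over the sample is taken with respect to the completed product measure, since a
  supremum over an uncountable class is in general at best measurable for the completion.
\<close>

definition sample_measure :: "'z measure \<Rightarrow> nat \<Rightarrow> (nat \<Rightarrow> 'z) measure" where
  "sample_measure Q N = completion (PiM {..<N} (\<lambda>_. Q))"

definition rademacher_complexity ::
  "('x \<times> 'y) measure \<Rightarrow> ('x \<Rightarrow> 'y) set \<Rightarrow> ('y \<Rightarrow> 'y \<Rightarrow> real) \<Rightarrow> nat \<Rightarrow> real" where
  "rademacher_complexity Q H h N =
     (\<integral>s. measure_pmf.expectation (Pi_pmf {..<N} 0 (\<lambda>_. pmf_of_set {-1, 1}))
            (\<lambda>\<sigma>. rademacher_sup H h N \<sigma> s) \<partial>sample_measure Q N) / real N"

text \<open>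
  The suprema whose expectation is the Rademacher complexity are integrable; without this the
  Bochner integral above would be the default value 0.
\<close>

definition rademacher_well_defined ::
  "('x \<times> 'y) measure \<Rightarrow> ('x \<Rightarrow> 'y) set \<Rightarrow> ('y \<Rightarrow> 'y \<Rightarrow> real) \<Rightarrow> bool" where
  "rademacher_well_defined Q H h \<longleftrightarrow>
     (\<forall>N\<ge>1. \<forall>\<sigma>\<in>{..<N} \<rightarrow> {-1, 1}. integrable (sample_measure Q N) (rademacher_sup H h N \<sigma>))"

definition vanishing_rademacher_rate ::
  "('x \<times> 'y) measure \<Rightarrow> ('x \<Rightarrow> 'y) set \<Rightarrow> ('y \<Rightarrow> 'y \<Rightarrow> real) \<Rightarrow> real
     \<Rightarrow> (nat \<Rightarrow> real \<Rightarrow> real) \<Rightarrow> bool" where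
  "vanishing_rademacher_rate Q H h b \<zeta> \<longleftrightarrow>
     (\<forall>N\<ge>1. \<forall>\<delta>\<in>{0<..<1}.
        \<zeta> N \<delta> = 2 * rademacher_complexity Q H h N + b * sqrt (ln (2 / \<delta>) / (2 * real N))) \<and>
     rademacher_complexity Q H h \<longlonglongrightarrow> 0"

definition L1_plus :: "'z measure \<Rightarrow> ('z \<Rightarrow> real) set" where
  "L1_plus D = {\<mu>. integrable D \<mu> \<and> (\<forall>z\<in>space D. 0 \<le> \<mu> z)}"

definition L1_plus_bounded :: "'z measure \<Rightarrow> real \<Rightarrow> ('z \<Rightarrow> real) set" where
  "L1_plus_bounded D \<gamma> = {\<mu> \<in> L1_plus D. esssup D (\<lambda>z. ereal \<bar>\<mu> z\<bar>) \<le> ereal \<gamma>}"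

definition lagrangian ::
  "('x \<times> 'y) measure \<Rightarrow> ('x \<times> 'y) measure \<Rightarrow> ('y \<Rightarrow> 'y \<Rightarrow> real) \<Rightarrow> ('y \<Rightarrow> 'y \<Rightarrow> real)
     \<Rightarrow> ('x \<Rightarrow> 'y) \<Rightarrow> ('x \<times> 'y \<Rightarrow> real) \<Rightarrow> real" where
  "lagrangian D0 D l0 l f \<mu> =
     (\<integral>z. loss_at l0 f z \<partial>D0) + (\<integral>z. \<mu> z * loss_at l f z \<partial>D)"

definition dual_fun ::
  "('x \<times> 'y) measure \<Rightarrow> ('x \<times> 'y) measure \<Rightarrow> ('x \<Rightarrow> 'y) set \<Rightarrow> ('y \<Rightarrow> 'y \<Rightarrow> real)
     \<Rightarrow> ('y \<Rightarrow> 'y \<Rightarrow> real) \<Rightarrow> ('x \<times> 'y \<Rightarrow> real) \<Rightarrow> real" where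
  "dual_fun D0 D H l0 l \<mu> = (INF f\<in>H. lagrangian D0 D l0 l f \<mu>)"

text \<open>
  Empirical counterparts at samples \<open>s0\<close>, \<open>s\<close>, indexed by \<open>{..<N}\<close>.
\<close>

definition emp_lagrangian ::
  "nat \<Rightarrow> (nat \<Rightarrow> 'x \<times> 'y) \<Rightarrow> (nat \<Rightarrow> 'x \<times> 'y) \<Rightarrow> ('y \<Rightarrow> 'y \<Rightarrow> real) \<Rightarrow> ('y \<Rightarrow> 'y \<Rightarrow> real)
     \<Rightarrow> ('x \<Rightarrow> 'y) \<Rightarrow> (nat \<Rightarrow> real) \<Rightarrow> real" where
  "emp_lagrangian N s0 s l0 l f \<mu> =
     (\<Sum>n<N. loss_at l0 f (s0 n)) / real N + (\<Sum>n<N. \<mu> n * loss_at l f (s n)) / real N"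

definition emp_dual_fun ::
  "nat \<Rightarrow> (nat \<Rightarrow> 'x \<times> 'y) \<Rightarrow> (nat \<Rightarrow> 'x \<times> 'y) \<Rightarrow> ('x \<Rightarrow> 'y) set \<Rightarrow> ('y \<Rightarrow> 'y \<Rightarrow> real)
     \<Rightarrow> ('y \<Rightarrow> 'y \<Rightarrow> real) \<Rightarrow> (nat \<Rightarrow> real) \<Rightarrow> real" where
  "emp_dual_fun N s0 s H l0 l \<mu> = (INF f\<in>H. emp_lagrangian N s0 s l0 l f \<mu>)"

end

theory Submission
  imports Defs
begin

text \<open>
  By minimax over randomized predictors, the restricted dual value is the infimum over mixtures
  \<open>p\<close> of \<open>E[l0(p)] + \<gamma> E[max 0 (l(p))]\<close>. Hence a near-optimal mixture, with Hoeffding's inequality,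
  bounds the empirical value from above, while an optimal multiplier \<open>\<lambda>\<close>, evaluated at
  the sample, bounds it from below, once \<open>\<lambda> \<cdot> l\<close> is shown to deviate uniformly over \<open>H\<close> by at most
  \<open>\<gamma> \<zeta>\<close>. The latter is symmetrization, contraction and McDiarmid's inequality. The relevant supremum over
  \<open>H\<close> need not be measurable; it is replaced by its minimal measurable majorant, which inherits
  the bounded differences almost everywhere. Weighted Rademacher suprema are
  dominated by convex combinations of unweighted ones, whose measurability is part of the
  assumptions.

  The bounded difference \<open>\<gamma> B / N\<close> of \<open>\<lambda> \<cdot> l\<close> requires \<open>0 \<le> c \<le> B\<close>. Outside this range \<open>l\<close> has
  constant sign, so a constant multiplier is optimal and uniform convergence of \<open>l\<close> suffices.
\<close>

section \<open>Attainment and minimax for bounded multipliers\<close>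

text \<open>A multiplier optimal for the sample is a vector of \<open>N\<close> numbers that depends
  on the sample, so it cannot be inserted into the population problem, and uniform convergence over
  \<open>H\<close> says nothing about it. The upper estimate therefore avoids multipliers: for a
  mixture fixed before the sample is drawn, the worst vector in \<open>[0, \<gamma>]^N\<close> is
  \<gamma> times the indicator of a positive mixed loss, and a single average of bounded variables
  remains. Mixtures have to enter because \<open>H\<close> need not be convex. In the opposite
  direction the population multiplier is fixed, but weighting by it produces a new class of
  functions, to which the rate of \<open>l\<close> transfers only through its explicit form: with
  \<open>t = B sqrt (ln (2 / \<delta>) / (2 N))\<close> the rate is \<open>2 R + t\<close>, the
  weighted class obeys the same \<open>R\<close>, and each one-sided tail at \<open>t\<close> costs
  \<open>\<delta> / 2\<close>. Of the two copies of the rate of \<open>l0\<close>, one pays for the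
  uniform deviation of \<open>l0\<close>, the other for the slack of the near-optimal
  mixture.\<close>

text \<open>
  Choosing almost norm-minimal elements of the nested convex sets of \<open>1 / n\<close>-optimal multipliers
  gives, by the parallelogram law, an \<open>L\<^sup>2\<close>-Cauchy sequence; this replaces weak-* compactness.
\<close>

lemma (in prob_space) multiplier_attained:
  fixes v :: "'i \<Rightarrow> 'a \<Rightarrow> real" and a :: "'i \<Rightarrow> real"
  assumes v: "\<And>i. i \<in> I \<Longrightarrow> v i \<in> borel_measurable M"
      "\<And>i z. i \<in> I \<Longrightarrow> z \<in> space M \<Longrightarrow> \<bar>v i z\<bar> \<le> K"
    and approx: "\<And>e. e > 0 \<Longrightarrow> \<exists>\<mu>\<in>borel_measurable M. (\<forall>z\<in>space M. \<mu> z \<in> {0..\<gamma>}) \<and>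
        (\<forall>i\<in>I. d - e \<le> a i + (\<integral>z. \<mu> z * v i z \<partial>M))"
  shows "\<exists>\<mu>\<in>borel_measurable M. (\<forall>z\<in>space M. \<mu> z \<in> {0..\<gamma>}) \<and>
        (\<forall>i\<in>I. d \<le> a i + (\<integral>z. \<mu> z * v i z \<partial>M))"
proof -
  define C where "C n = {\<mu>\<in>borel_measurable M. (\<forall>z\<in>space M. \<mu> z \<in> {0..\<gamma>}) \<and>
        (\<forall>i\<in>I. d - 1 / real (Suc n) \<le> a i + (\<integral>z. \<mu> z * v i z \<partial>M))}" for n
  define q where "q \<mu> = (\<integral>z. (\<mu> z)\<^sup>2 \<partial>M)" for \<mu> :: "'a \<Rightarrow> real"
  define \<alpha> where "\<alpha> n = (INF \<mu>\<in>C n. q \<mu>)" for n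
  have C_meas: "\<mu> \<in> borel_measurable M" if "\<mu> \<in> C n" for \<mu> n
    using that by (simp add: C_def)
  have C_range: "0 \<le> \<mu> z" "\<mu> z \<le> \<gamma>" if "\<mu> \<in> C n" "z \<in> space M" for \<mu> n z
    using that by (auto simp: C_def)
  have C_int: "integrable M (\<lambda>z. \<mu> z * v i z)" if "\<mu> \<in> C n" "i \<in> I" for \<mu> n i
  proof (rule integrable_const_bound[where B="\<gamma> * K"])
    show "(\<lambda>z. \<mu> z * v i z) \<in> borel_measurable M"
      by (intro borel_measurable_times C_meas[OF that(1)] v(1)[OF that(2)])
    show "AE z in M. norm (\<mu> z * v i z) \<le> \<gamma> * K"
    proof (rule AE_I2)
      fix z assume z: "z \<in> space M"
      show "norm (\<mu> z * v i z) \<le> \<gamma> * K"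
        using C_range[OF that(1) z] v(2)[OF that(2) z] by (simp add: abs_mult mult_mono)
    qed
  qed
  have sq_int: "integrable M (\<lambda>z. (\<mu> z)\<^sup>2)" "integrable M (\<lambda>z. (\<mu> z - \<nu> z)\<^sup>2)"
    "integrable M (\<lambda>z. ((\<mu> z + \<nu> z) / 2)\<^sup>2)" "integrable M (\<lambda>z. \<mu> z - \<nu> z)" "integrable M \<mu>"
    if "\<mu> \<in> C n" "\<nu> \<in> C m" for \<mu> \<nu> n m
  proof -
    note [measurable] = C_meas[OF that(1)] C_meas[OF that(2)]
    have *: "\<bar>\<mu> z\<bar> \<le> \<gamma>" "\<bar>\<mu> z - \<nu> z\<bar> \<le> \<gamma>" "\<bar>(\<mu> z + \<nu> z) / 2\<bar> \<le> \<gamma>" if "z \<in> space M" for z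
      using C_range[OF \<open>\<mu> \<in> C n\<close> that] C_range[OF \<open>\<nu> \<in> C m\<close> that] by auto
    have sq: "integrable M (\<lambda>z. (f z)\<^sup>2)"
      if "f \<in> borel_measurable M" "\<And>z. z \<in> space M \<Longrightarrow> \<bar>f z\<bar> \<le> \<gamma>" for f
    proof (rule integrable_const_bound[where B="\<gamma>\<^sup>2"])
      show "AE z in M. norm ((f z)\<^sup>2) \<le> \<gamma>\<^sup>2"
        using power_mono[OF that(2), of _ 2] by (intro AE_I2) simp
    qed (use that(1) in measurable)
    show "integrable M (\<lambda>z. (\<mu> z)\<^sup>2)" "integrable M (\<lambda>z. (\<mu> z - \<nu> z)\<^sup>2)"
      "integrable M (\<lambda>z. ((\<mu> z + \<nu> z) / 2)\<^sup>2)"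
      by (intro sq; use * in simp)+
    show "integrable M (\<lambda>z. \<mu> z - \<nu> z)" "integrable M \<mu>"
      by (intro integrable_const_bound[where B="\<gamma>"] AE_I2; simp add: *)+
  qed
  have C_ne: "C n \<noteq> {}" for n
    using approx[of "1 / real (Suc n)"] by (auto simp: C_def)
  have C_anti: "C m \<subseteq> C n" if "n \<le> m" for n m
  proof
    fix \<mu> assume "\<mu> \<in> C m"
    moreover have "1 / real (Suc m) \<le> 1 / real (Suc n)" using that by (simp add: field_simps)
    ultimately show "\<mu> \<in> C n" unfolding C_def by fastforce
  qed
  have C_mid: "(\<lambda>z. (\<mu> z + \<nu> z) / 2) \<in> C n" if "\<mu> \<in> C n" "\<nu> \<in> C n" for \<mu> \<nu> n
  proof -
    note [measurable] = C_meas[OF that(1)] C_meas[OF that(2)]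
    have "d - 1 / real (Suc n) \<le> a i + (\<integral>z. (\<mu> z + \<nu> z) / 2 * v i z \<partial>M)" if i: "i \<in> I" for i
    proof -
      have "(\<integral>z. (\<mu> z + \<nu> z) / 2 * v i z \<partial>M) = (\<integral>z. (\<mu> z * v i z + \<nu> z * v i z) / 2 \<partial>M)"
        by (simp add: field_simps)
      also have "\<dots> = ((\<integral>z. \<mu> z * v i z \<partial>M) + (\<integral>z. \<nu> z * v i z \<partial>M)) / 2"
        using C_int[OF \<open>\<mu> \<in> C n\<close> i] C_int[OF \<open>\<nu> \<in> C n\<close> i] by simp
      finally have mid: "(\<integral>z. (\<mu> z + \<nu> z) / 2 * v i z \<partial>M) =
          ((\<integral>z. \<mu> z * v i z \<partial>M) + (\<integral>z. \<nu> z * v i z \<partial>M)) / 2" .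
      have "d - 1 / real (Suc n) \<le> a i + (\<integral>z. \<mu> z * v i z \<partial>M)"
        "d - 1 / real (Suc n) \<le> a i + (\<integral>z. \<nu> z * v i z \<partial>M)"
        using \<open>\<mu> \<in> C n\<close> \<open>\<nu> \<in> C n\<close> i by (auto simp: C_def)
      then show ?thesis unfolding mid by argo
    qed
    moreover have "(\<mu> z + \<nu> z) / 2 \<in> {0..\<gamma>}" if "z \<in> space M" for z
      using C_range[OF \<open>\<mu> \<in> C n\<close> that] C_range[OF \<open>\<nu> \<in> C n\<close> that] by auto
    ultimately show ?thesis by (simp add: C_def)
  qed
  have q_nn: "0 \<le> q \<mu>" for \<mu> unfolding q_def by simp
  have q_bdd: "bdd_below (q ` C n)" for n using q_nn by (intro bdd_belowI[of _ 0]) auto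
  have \<alpha>_le: "\<alpha> n \<le> q \<mu>" if "\<mu> \<in> C n" for \<mu> n
    unfolding \<alpha>_def using q_bdd that by (rule cINF_lower)
  have q_le: "q \<mu> \<le> \<gamma>\<^sup>2" if "\<mu> \<in> C n" for \<mu> n
  proof -
    have "q \<mu> \<le> (\<integral>z. \<gamma>\<^sup>2 \<partial>M)" unfolding q_def
      using C_range[OF that] sq_int(1)[OF that that] by (intro integral_mono) (auto intro!: power_mono)
    then show ?thesis by (simp add: prob_space)
  qed
  have \<alpha>_bd: "\<alpha> n \<le> \<gamma>\<^sup>2" for n using C_ne[of n] \<alpha>_le q_le by (meson ex_in_conv order_trans)
  \<comment> \<open>The sets shrink, so the least squared norms increase; being bounded they are
    Cauchy, which the parallelogram estimate needs.\<close>
  have "incseq \<alpha>" unfolding incseq_def \<alpha>_def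
    using C_ne C_anti q_bdd by (auto intro!: cINF_superset_mono)
  with \<alpha>_bd have "convergent \<alpha>" 
    by (metis Bseq_mono_convergent incseq_def incseq_bounded)
  then have \<alpha>_Cauchy: "Cauchy \<alpha>" by (rule convergent_Cauchy)
  have "\<exists>\<mu>\<in>C n. q \<mu> < \<alpha> n + 1 / real (Suc n)" for n
    using cINF_less_iff[OF C_ne q_bdd, of n "\<alpha> n + 1 / real (Suc n)"] unfolding \<alpha>_def[symmetric] by simp
  then obtain h where h: "\<And>n. h n \<in> C n" and hq: "\<And>n. q (h n) < \<alpha> n + 1 / real (Suc n)" by metis
  have hm[measurable]: "h n \<in> borel_measurable M" for n using h by (rule C_meas)
  \<comment> \<open>The midpoint of \<open>h m\<close> and \<open>h n\<close> stays in the convex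
    set \<open>C n\<close>, so its squared norm is at least \<open>\<alpha> n\<close>; this caps the
    difference.\<close>
  have par: "q (\<lambda>z. h m z - h n z) \<le> 2 * (\<alpha> m - \<alpha> n) + 4 / real (Suc n)" if "n \<le> m" for n m
  proof -
    have hmn: "h m \<in> C n" using h C_anti[OF that] by auto
    have "q (\<lambda>z. h m z - h n z) + 4 * q (\<lambda>z. (h m z + h n z) / 2) =
      (\<integral>z. (h m z - h n z)\<^sup>2 + 4 * ((h m z + h n z) / 2)\<^sup>2 \<partial>M)"
      unfolding q_def using sq_int[OF hmn h[of n]] by simp
    also have "\<dots> = (\<integral>z. 2 * (h m z)\<^sup>2 + 2 * (h n z)\<^sup>2 \<partial>M)"
      by (intro Bochner_Integration.integral_cong) (auto simp: power2_eq_square field_simps)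
    also have "\<dots> = 2 * q (h m) + 2 * q (h n)"
      unfolding q_def using sq_int(1)[OF hmn h[of n]] sq_int(1)[OF h[of n] hmn] by simp
    finally have "q (\<lambda>z. h m z - h n z) = 2 * q (h m) + 2 * q (h n) - 4 * q (\<lambda>z. (h m z + h n z) / 2)"
      by simp
    moreover have "1 / real (Suc m) \<le> 1 / real (Suc n)" using that by (simp add: field_simps)
    ultimately show ?thesis using \<alpha>_le[OF C_mid[OF hmn h[of n]]] hq[of m] hq[of n] by simp
  qed
  have L1: "\<exists>N. \<forall>i\<ge>N. \<forall>j\<ge>N. (\<integral>z. norm (h i z - h j z) \<partial>M) < e" if e: "e > 0" for e
  proof -
    have "0 < e\<^sup>2 / 16" using e by simp
    with \<alpha>_Cauchy obtain N1 where N1: "\<And>m n. m \<ge> N1 \<Longrightarrow> n \<ge> N1 \<Longrightarrow> \<bar>\<alpha> m - \<alpha> n\<bar> < e\<^sup>2 / 16"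
      unfolding Cauchy_def dist_real_def by metis
    obtain N2 where N2: "1 / real (Suc N2) < e\<^sup>2 / 32" using nat_approx_posE[of "e\<^sup>2 / 32"] e by auto
    have key: "(\<integral>z. norm (h m z - h n z) \<partial>M) < e" if mn: "n \<le> m" "n \<ge> max N1 N2" for m n
    proof -
      have qb: "q (\<lambda>z. h m z - h n z) < e\<^sup>2 / 4"
      proof -
        have "1 / real (Suc n) \<le> 1 / real (Suc N2)" using mn by (simp add: field_simps)
        then have "4 / real (Suc n) < e\<^sup>2 / 8" using N2 by simp
        moreover have "\<alpha> m - \<alpha> n < e\<^sup>2 / 16" by (rule le_less_trans[OF abs_ge_self N1]) (use mn in auto)
        ultimately show ?thesis using par[OF mn(1)] by argo
      qed
      \<comment> \<open>The pointwise bound \<open>|x| \<le> e / 4 + x^2 / e\<close> passes from L^2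
        to L^1, where almost everywhere convergent subsequences are available.\<close>
      have "(\<integral>z. norm (h m z - h n z) \<partial>M) \<le> (\<integral>z. e / 4 + (h m z - h n z)\<^sup>2 / e \<partial>M)"
      proof (intro integral_mono integrable_norm)
        show "integrable M (\<lambda>z. h m z - h n z)" "integrable M (\<lambda>z. e / 4 + (h m z - h n z)\<^sup>2 / e)"
          using sq_int[OF h[of m] h[of n]] by auto
        fix z
        have "0 \<le> (\<bar>h m z - h n z\<bar> - e / 2)\<^sup>2 / e" using e by simp
        also have "\<dots> = (h m z - h n z)\<^sup>2 / e - \<bar>h m z - h n z\<bar> + e / 4"
          using e by (simp add: power2_eq_square field_simps)
        finally show "norm (h m z - h n z) \<le> e / 4 + (h m z - h n z)\<^sup>2 / e" by simp
      qed
      also have "\<dots> = e / 4 + q (\<lambda>z. h m z - h n z) / e"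
        using sq_int[OF h[of m] h[of n]] by (simp add: q_def prob_space)
      also have "\<dots> < e / 4 + (e\<^sup>2 / 4) / e" using divide_strict_right_mono[OF qb e] by simp
      also have "\<dots> < e" using e by (simp add: power2_eq_square)
      finally show ?thesis .
    qed
    show ?thesis
    proof (intro exI allI impI)
      fix i j assume "max N1 N2 \<le> i" "max N1 N2 \<le> j"
      then show "(\<integral>z. norm (h i z - h j z) \<partial>M) < e"
        using key[of i j] key[of j i] by (cases "i \<le> j") (auto simp: abs_minus_commute)
    qed
  qed
  obtain r where r: "strict_mono r" and rc: "AE z in M. Cauchy (\<lambda>k. h (r k) z)"
    using cauchy_L1_AE_cauchy_subseq[of M h] sq_int(5)[OF h h] L1 by blast
  \<comment> \<open>Clipping alters the limit only on the null set without convergence, but makes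
    the range condition hold at every point.\<close>
  define \<mu> where "\<mu> z = min \<gamma> (max 0 (lim (\<lambda>k. h (r k) z)))" for z
  have [measurable]: "\<mu> \<in> borel_measurable M" unfolding \<mu>_def by measurable
  have \<gamma>: "0 \<le> \<gamma>" using C_range[OF h] not_empty by (meson ex_in_conv order_trans)
  have conv: "AE z in M. (\<lambda>k. h (r k) z) \<longlonglongrightarrow> \<mu> z"
    using rc AE_space
  proof eventually_elim
    case (elim z)
    then have "convergent (\<lambda>k. h (r k) z)" by (simp add: Cauchy_convergent_iff)
    then have l: "(\<lambda>k. h (r k) z) \<longlonglongrightarrow> lim (\<lambda>k. h (r k) z)" by (simp add: convergent_LIMSEQ_iff)
    have "0 \<le> lim (\<lambda>k. h (r k) z)" "lim (\<lambda>k. h (r k) z) \<le> \<gamma>"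
      using C_range[OF h elim(2)] by (auto intro!: LIMSEQ_le_const[OF l] LIMSEQ_le_const2[OF l])
    with l show ?case by (simp add: \<mu>_def)
  qed
  have "d \<le> a i + (\<integral>z. \<mu> z * v i z \<partial>M)" if i: "i \<in> I" for i
  proof -
    note [measurable] = v(1)[OF i]
    have "(\<lambda>k. \<integral>z. h (r k) z * v i z \<partial>M) \<longlonglongrightarrow> (\<integral>z. \<mu> z * v i z \<partial>M)"
    proof (rule integral_dominated_convergence[where w="\<lambda>_. \<gamma> * K"])
      show "AE z in M. (\<lambda>k. h (r k) z * v i z) \<longlonglongrightarrow> \<mu> z * v i z"
        using conv by eventually_elim (intro tendsto_intros)
      show "AE z in M. norm (h (r k) z * v i z) \<le> \<gamma> * K" for k
      proof (rule AE_I2)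
        fix z assume z: "z \<in> space M"
        show "norm (h (r k) z * v i z) \<le> \<gamma> * K"
          using C_range[OF h z] v(2)[OF i z] \<gamma> by (simp add: abs_mult mult_mono)
      qed
    qed auto
    then have "(\<lambda>k. a i + (\<integral>z. h (r k) z * v i z \<partial>M)) \<longlonglongrightarrow> a i + (\<integral>z. \<mu> z * v i z \<partial>M)"
      by (intro tendsto_intros)
    moreover have "(\<lambda>k. d - 1 / real (Suc k)) \<longlonglongrightarrow> d - 0"
      by (intro tendsto_intros LIMSEQ_Suc[OF lim_1_over_n])
    moreover have "d - 1 / real (Suc k) \<le> a i + (\<integral>z. h (r k) z * v i z \<partial>M)" for k
    proof -
      have "h (r k) \<in> C k" using h C_anti[OF seq_suble[OF r, of k]] by auto
      then show ?thesis using i by (simp add: C_def)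
    qed
    ultimately show ?thesis by (intro LIMSEQ_le[of "\<lambda>k. d - 1 / real (Suc k)" d]) auto
  qed
  moreover have "\<mu> z \<in> {0..\<gamma>}" for z using \<gamma> by (auto simp: \<mu>_def)
  ultimately show ?thesis by (intro bexI[of _ \<mu>]) auto
qed

text \<open>\<open>\<phi> x\<close> is the maximum of \<open>r * x - \<eta> * r^2 / 2\<close> over
  \<open>r\<close> in \<open>[0, 1]\<close>, attained at \<open>r = s x\<close>: a Huber-type
  smoothing of \<open>max 0\<close> with derivative \<open>s\<close> and curvature at most
  \<open>1 / \<eta>\<close>. Since \<open>s\<close> takes values in \<open>[0, 1]\<close>,
  \<open>\<gamma> * s\<close> is automatically an admissible multiplier.\<close>

lemma smoothed_hinge_bounds:
  fixes s \<phi> :: "real \<Rightarrow> real"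
  assumes \<eta>: "\<eta> > 0"
    and s: "\<And>x. s x = max 0 (min 1 (x / \<eta>))" and \<phi>: "\<And>x. \<phi> x = s x * x - \<eta> * (s x)\<^sup>2 / 2"
  shows "0 \<le> \<phi> x" "\<phi> (x + y) \<le> \<phi> x + s x * y + y\<^sup>2 / (2 * \<eta>)" "max 0 x \<le> s x * x + \<eta>"
    "\<phi> x \<le> \<bar>x\<bar>"
proof -
  have s01: "0 \<le> s x" "s x \<le> 1" for x by (auto simp: s)
  have sx: "\<eta> * s x \<le> s x * x / s x" if "s x \<noteq> 0" for x
    using that \<eta> by (auto simp: s max_def min_def field_simps split: if_splits)
  have sx2: "\<eta> * (s x)\<^sup>2 \<le> s x * x" for x
  proof (cases "s x = 0")
    case False
    then have "\<eta> * s x \<le> x" using sx[of x] by simp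
    then have "s x * (\<eta> * s x) \<le> s x * x" by (rule mult_left_mono) (rule s01)
    then show ?thesis by (simp add: power2_eq_square mult_ac)
  qed auto
  have "0 \<le> \<eta> * (s x)\<^sup>2" using \<eta> by simp
  with sx2[of x] show "0 \<le> \<phi> x" unfolding \<phi> by linarith
  \<comment> \<open>The variational inequality of the maximizer \<open>s x\<close>: the first factor
    is an admissible direction, the second the derivative of the concave objective.\<close>
  have "(r - s x) * (x - \<eta> * s x) \<le> 0" if r: "0 \<le> r" "r \<le> 1" for r
  proof -
    consider "x \<le> 0" | "\<eta> \<le> x" | "0 < x" "x < \<eta>" by linarith
    then show ?thesis
    proof cases
      case 1
      then have "x / \<eta> \<le> 0" using \<eta> by (intro divide_nonpos_pos)
      then have "s x = 0" by (simp add: s)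
      then show ?thesis using 1 r by (simp add: mult_nonneg_nonpos)
    next
      case 2
      then have "s x = 1" using \<eta> by (simp add: s max_def min_def)
      then show ?thesis using 2 r by (simp add: mult_nonpos_nonneg)
    next
      case 3
      then have "s x = x / \<eta>" using \<eta> by (simp add: s max_def min_def)
      then show ?thesis using \<eta> by simp
    qed
  qed
  from this[OF s01, of "x + y"]
  have opt: "(s (x + y) - s x) * (x - \<eta> * s x) \<le> 0" .
  \<comment> \<open>Young's inequality: the quadratic penalty in the change of \<open>s\<close>
    absorbs its product with \<open>y\<close>.\<close>
  have "0 \<le> (\<eta> * (s (x + y) - s x) - y)\<^sup>2 / (2 * \<eta>)" using \<eta> by simp
  also have "\<dots> = \<eta> * (s (x + y) - s x)\<^sup>2 / 2 - (s (x + y) - s x) * y + y\<^sup>2 / (2 * \<eta>)"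
    using \<eta> by (simp add: power2_eq_square field_simps)
  finally have sq: "(s (x + y) - s x) * y \<le> \<eta> * (s (x + y) - s x)\<^sup>2 / 2 + y\<^sup>2 / (2 * \<eta>)" by simp
  have "\<phi> (x + y) - \<phi> x - s x * y =
     (s (x + y) - s x) * (x - \<eta> * s x) + (s (x + y) - s x) * y - \<eta> * (s (x + y) - s x)\<^sup>2 / 2"
    unfolding \<phi> by (simp add: power2_eq_square field_simps)
  with opt sq show "\<phi> (x + y) \<le> \<phi> x + s x * y + y\<^sup>2 / (2 * \<eta>)" by linarith
  show "max 0 x \<le> s x * x + \<eta>"
  proof (cases "\<eta> \<le> x")
    case True
    then have "s x = 1" using \<eta> by (simp add: s max_def min_def)
    then show ?thesis using True \<eta> by simp
  next
    case False
    have "0 \<le> \<eta> * (s x)\<^sup>2" using \<eta> by simp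
    with False sx2[of x] \<eta> show ?thesis by linarith
  qed
  have "\<phi> x \<le> s x * x" using \<open>0 \<le> \<eta> * (s x)\<^sup>2\<close> unfolding \<phi> by simp
  also have "\<dots> \<le> s x * \<bar>x\<bar>" using s01 by (intro mult_left_mono) auto
  also have "\<dots> \<le> \<bar>x\<bar>" using s01 by (intro mult_left_le_one_le) auto
  finally show "\<phi> x \<le> \<bar>x\<bar>" .
qed

text \<open>
  Minimax without separation or compactness: \<open>max 0\<close> is smoothed to \<open>\<phi>\<close>, and at a mixture \<open>u\<close> that nearly
  minimizes the smoothed objective, \<open>\<gamma> \<cdot> \<phi>' u\<close> is an admissible multiplier, so the first-order
  condition in the direction of every \<open>i \<in> I\<close> contradicts a gap.
\<close>

lemma (in prob_space) saddle_mixture: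
  fixes v :: "'i \<Rightarrow> 'a \<Rightarrow> real" and a :: "'i \<Rightarrow> real"
  assumes v: "\<And>i. i \<in> I \<Longrightarrow> v i \<in> borel_measurable M"
      "\<And>i z. i \<in> I \<Longrightarrow> z \<in> space M \<Longrightarrow> \<bar>v i z\<bar> \<le> K"
    and a: "\<And>i. i \<in> I \<Longrightarrow> A \<le> a i"
    and \<gamma>: "0 \<le> \<gamma>" and \<epsilon>: "0 < \<epsilon>"
    and d: "\<And>\<mu>. \<mu> \<in> borel_measurable M \<Longrightarrow> (\<And>z. z \<in> space M \<Longrightarrow> \<mu> z \<in> {0..\<gamma>}) \<Longrightarrow>
        \<exists>i\<in>I. a i + (\<integral>z. \<mu> z * v i z \<partial>M) < d"
  shows "\<exists>F p. finite F \<and> F \<subseteq> I \<and> (\<forall>i\<in>F. 0 \<le> p i) \<and> sum p F = 1 \<and>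
        (\<Sum>i\<in>F. p i * a i) + \<gamma> * (\<integral>z. max 0 (\<Sum>i\<in>F. p i * v i z) \<partial>M) \<le> d + \<epsilon>"
proof -
  obtain i0 where i0: "i0 \<in> I" using d[of "\<lambda>_. 0"] \<gamma> by auto
  have K: "0 \<le> K" using v(2)[OF i0] not_empty by (meson abs_ge_zero ex_in_conv order_trans)
  \<comment> \<open>\<epsilon> is split in thirds: smoothing costs \<open>\<gamma> * \<eta>\<close>,
    the second-order remainder \<open>t * C\<close>, and near-minimality of \<open>x\<close> the
    rest.\<close>
  define \<eta> where "\<eta> = \<epsilon> / (3 * (\<gamma> + 1))"
  have \<eta>: "0 < \<eta>" "\<gamma> * \<eta> \<le> \<epsilon> / 3" using \<epsilon> \<gamma> by (auto simp: \<eta>_def field_simps)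
  define s where "s x = max 0 (min 1 (x / \<eta>))" for x :: real
  define \<phi> where "\<phi> x = s x * x - \<eta> * (s x)\<^sup>2 / 2" for x :: real
  note hinge = smoothed_hinge_bounds[OF \<eta>(1) s_def \<phi>_def]
  have s01: "0 \<le> s x" "s x \<le> 1" for x by (auto simp: s_def)
  have [measurable]: "s \<in> borel_measurable borel" "\<phi> \<in> borel_measurable borel"
    unfolding s_def[abs_def] \<phi>_def[abs_def] by measurable
  \<comment> \<open>Weights vanish off \<open>F\<close>, so that adding an index to \<open>F\<close>
    changes no sum, whether or not the index was already there.\<close>
  define PP where "PP = {(F, p). finite F \<and> F \<subseteq> I \<and> (\<forall>i. 0 \<le> (p i :: real)) \<and> (\<forall>i. i \<notin> F \<longrightarrow> p i = 0) \<and> sum p F = 1}"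
  define av where "av = (\<lambda>(F, p). \<Sum>i\<in>F. p i * a i)"
  define u where "u = (\<lambda>(F, p) z. \<Sum>i\<in>F. p i * v i z)"
  define J where "J x = av x + \<gamma> * (\<integral>z. \<phi> (u x z) \<partial>M)" for x
  have um: "u x \<in> borel_measurable M" if "x \<in> PP" for x
    using that v(1) unfolding PP_def u_def by (auto intro!: borel_measurable_sum borel_measurable_times)
  have ub: "\<bar>u x z\<bar> \<le> K" if "x \<in> PP" "z \<in> space M" for x z
  proof -
    obtain F p where x: "x = (F, p)" by force
    have "\<bar>u x z\<bar> \<le> (\<Sum>i\<in>F. \<bar>p i * v i z\<bar>)" unfolding u_def x by (simp add: sum_abs)
    also have "\<dots> \<le> (\<Sum>i\<in>F. p i * K)"
      using that v(2) unfolding PP_def x by (intro sum_mono) (auto simp: abs_mult intro!: mult_left_mono)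
    also have "\<dots> = K" using that by (simp add: PP_def x sum_distrib_right[symmetric])
    finally show ?thesis .
  qed
  have avA: "A \<le> av x" if "x \<in> PP" for x
  proof -
    obtain F p where x: "x = (F, p)" by force
    have "A = (\<Sum>i\<in>F. p i * A)" using that by (simp add: PP_def x sum_distrib_right[symmetric])
    also have "\<dots> \<le> av x" using that a unfolding PP_def x av_def by (auto intro!: sum_mono mult_left_mono)
    finally show ?thesis .
  qed
  have bint: "integrable M f" if "f \<in> borel_measurable M" "\<And>z. z \<in> space M \<Longrightarrow> \<bar>f z\<bar> \<le> B" for f :: "'a \<Rightarrow> real" and B
    using that by (intro integrable_const_bound[where B=B] AE_I2) auto
  have \<phi>int: "integrable M (\<lambda>z. \<phi> (u x z))" if "x \<in> PP" for x
  proof (rule bint[of _ K])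
    show "(\<lambda>z. \<phi> (u x z)) \<in> borel_measurable M" using um[OF that] by simp
    show "\<bar>\<phi> (u x z)\<bar> \<le> K" if "z \<in> space M" for z
      using hinge(1)[of "u x z"] hinge(4)[of "u x z"] ub[OF \<open>x \<in> PP\<close> that] by linarith
  qed
  have J_lower: "A \<le> J x" if "x \<in> PP" for x
    using avA[OF that] \<gamma> hinge(1) by (simp add: J_def add_increasing2)
  then have J_bdd: "bdd_below (J ` PP)" by (intro bdd_belowI[of _ A]) auto
  have "({i0}, \<lambda>i. if i = i0 then 1 else 0) \<in> PP" using i0 by (auto simp: PP_def)
  then have PP_ne: "PP \<noteq> {}" by blast
  \<comment> \<open>The quadratic remainder of the smoothness bound, with \<open>2 * K\<close> as
    the largest distance between \<open>v i\<close> and the mixture, times \<gamma>.\<close>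
  define C where "C = 2 * \<gamma> * K\<^sup>2 / \<eta>"
  have C: "0 \<le> C" using \<gamma> \<eta> by (simp add: C_def)
  define t where "t = min 1 (\<epsilon> / (3 * (C + 1)))"
  have t: "0 < t" "t \<le> 1" using \<epsilon> C by (auto simp: t_def)
  have tC: "t * C \<le> \<epsilon> / 3"
  proof -
    have "t * C \<le> \<epsilon> / (3 * (C + 1)) * C" using C by (intro mult_right_mono) (auto simp: t_def)
    also have "\<dots> \<le> \<epsilon> / 3" using C \<epsilon> by (simp add: field_simps)
    finally show ?thesis .
  qed
  \<comment> \<open>The slack is proportional to \<open>t\<close>, so dividing the first-order
    inequality by \<open>t\<close> leaves \<open>\<epsilon> / 3\<close>.\<close>
  obtain x where x: "x \<in> PP" and xJ: "J x < (INF y\<in>PP. J y) + t * \<epsilon> / 3"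
    using cINF_less_iff[OF PP_ne J_bdd, of "(INF y\<in>PP. J y) + t * \<epsilon> / 3"] t \<epsilon> by auto
  obtain F p where xFp: "x = (F, p)" by force
  note [measurable] = um[OF x]
  define \<mu> where "\<mu> z = \<gamma> * s (u x z)" for z
  have [measurable]: "\<mu> \<in> borel_measurable M" unfolding \<mu>_def by measurable
  have \<mu>01: "0 \<le> \<mu> z" "\<mu> z \<le> \<gamma>" for z using s01 \<gamma> by (auto simp: \<mu>_def intro!: mult_left_le)
  then obtain i where i: "i \<in> I" and id: "a i + (\<integral>z. \<mu> z * v i z \<partial>M) < d" using d[of \<mu>] by auto
  note [measurable] = v(1)[OF i]
  have \<mu>uint: "integrable M (\<lambda>z. \<mu> z * u x z)" and \<mu>vint: "integrable M (\<lambda>z. \<mu> z * v i z)"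
    using \<mu>01 ub[OF x] v(2)[OF i] \<gamma> by (auto intro!: bint[of _ "\<gamma> * K"] simp: abs_mult intro!: mult_mono)
  \<comment> \<open>A step of length \<open>t\<close> from the mixture towards the pure index
    \<open>i\<close> that the hypothesis on \<open>d\<close> supplies for the multiplier
    \<mu>.\<close>
  define y where "y = (insert i F, \<lambda>j. (1 - t) * p j + (if j = i then t else 0))"
  have Fp: "finite F" "F \<subseteq> I" "\<And>i. 0 \<le> p i" "\<And>i. i \<notin> F \<Longrightarrow> p i = 0" "sum p F = 1"
    using x by (auto simp: PP_def xFp)
  have ysum: "(\<Sum>j\<in>insert i F. ((1 - t) * p j + (if j = i then t else 0)) * f j) =
      (1 - t) * (\<Sum>j\<in>F. p j * f j) + t * f i" for f
  proof -
    have "(\<Sum>j\<in>insert i F. ((1 - t) * p j + (if j = i then t else 0)) * f j) =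
      (1 - t) * (\<Sum>j\<in>insert i F. p j * f j) + (\<Sum>j\<in>insert i F. if j = i then t * f j else 0)"
      by (simp only: sum_distrib_left sum.distrib[symmetric]) (intro sum.cong; simp add: algebra_simps)
    also have "(\<Sum>j\<in>insert i F. p j * f j) = (\<Sum>j\<in>F. p j * f j)"
      using Fp by (cases "i \<in> F") (auto simp: insert_absorb)
    also have "(\<Sum>j\<in>insert i F. if j = i then t * f j else 0) = t * f i"
      using Fp(1) by simp
    finally show ?thesis .
  qed
  have y: "y \<in> PP"
    using ysum[of "\<lambda>_. 1"] Fp i t by (auto simp: PP_def y_def)
  have avy: "av y = (1 - t) * av x + t * a i" using ysum[of a] by (simp add: av_def y_def xFp)
  have uy: "u y z = u x z + t * (v i z - u x z)" for z
    using ysum[of "\<lambda>j. v j z"] by (simp add: u_def y_def xFp algebra_simps)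
  have "\<gamma> * (\<integral>z. \<phi> (u y z) \<partial>M) = (\<integral>z. \<gamma> * \<phi> (u y z) \<partial>M)" by simp
  also have "\<dots> \<le> (\<integral>z. \<gamma> * \<phi> (u x z) + t * (\<mu> z * v i z - \<mu> z * u x z) + t\<^sup>2 * C \<partial>M)"
  proof (rule integral_mono)
    fix z assume z: "z \<in> space M"
    have "\<bar>v i z - u x z\<bar> \<le> 2 * K" using ub[OF x z] v(2)[OF i z] by linarith
    then have "(v i z - u x z)\<^sup>2 \<le> (2 * K)\<^sup>2" by (metis abs_ge_zero power2_abs power_mono)
    then have "\<gamma> * ((t * (v i z - u x z))\<^sup>2 / (2 * \<eta>)) \<le> \<gamma> * ((t\<^sup>2 * (2 * K)\<^sup>2) / (2 * \<eta>))"
      using \<gamma> \<eta> by (intro mult_left_mono divide_right_mono) (auto simp: power_mult_distrib intro!: mult_left_mono)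
    also have "\<dots> = t\<^sup>2 * C" by (simp add: C_def power2_eq_square field_simps)
    finally have 1: "\<gamma> * ((t * (v i z - u x z))\<^sup>2 / (2 * \<eta>)) \<le> t\<^sup>2 * C" .
    have "\<gamma> * \<phi> (u y z) \<le> \<gamma> * (\<phi> (u x z) + s (u x z) * (t * (v i z - u x z)) + (t * (v i z - u x z))\<^sup>2 / (2 * \<eta>))"
      unfolding uy using \<gamma> by (intro mult_left_mono hinge(2))
    also have "\<dots> = \<gamma> * \<phi> (u x z) + t * (\<mu> z * v i z - \<mu> z * u x z) + \<gamma> * ((t * (v i z - u x z))\<^sup>2 / (2 * \<eta>))"
      by (simp add: \<mu>_def algebra_simps)
    finally show "\<gamma> * \<phi> (u y z) \<le> \<gamma> * \<phi> (u x z) + t * (\<mu> z * v i z - \<mu> z * u x z) + t\<^sup>2 * C"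
      using 1 by linarith
  qed (use \<phi>int[OF x] \<phi>int[OF y] \<mu>uint \<mu>vint in auto)
  also have "\<dots> = \<gamma> * (\<integral>z. \<phi> (u x z) \<partial>M) + t * ((\<integral>z. \<mu> z * v i z \<partial>M) - (\<integral>z. \<mu> z * u x z \<partial>M)) + t\<^sup>2 * C"
    using \<phi>int[OF x] \<mu>uint \<mu>vint by (simp add: prob_space)
  finally have "J y \<le> J x + t * (a i - av x + (\<integral>z. \<mu> z * v i z \<partial>M) - (\<integral>z. \<mu> z * u x z \<partial>M)) + t\<^sup>2 * C"
    by (simp add: J_def avy algebra_simps)
  moreover have "(INF y\<in>PP. J y) \<le> J y" by (rule cINF_lower[OF J_bdd y])
  ultimately have "0 < t * \<epsilon> / 3 + t * (a i - av x + (\<integral>z. \<mu> z * v i z \<partial>M) - (\<integral>z. \<mu> z * u x z \<partial>M)) + t\<^sup>2 * C"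
    using xJ by linarith
  also have "\<dots> = t * (\<epsilon> / 3 + (a i - av x + (\<integral>z. \<mu> z * v i z \<partial>M) - (\<integral>z. \<mu> z * u x z \<partial>M)) + t * C)"
    by (simp add: power2_eq_square algebra_simps)
  finally have "0 < \<epsilon> / 3 + (a i - av x + (\<integral>z. \<mu> z * v i z \<partial>M) - (\<integral>z. \<mu> z * u x z \<partial>M)) + t * C"
    using t by (simp add: zero_less_mult_iff)
  then have near: "av x + (\<integral>z. \<mu> z * u x z \<partial>M) < d + 2 * \<epsilon> / 3" using tC id by linarith
  have "\<gamma> * (\<integral>z. max 0 (u x z) \<partial>M) = (\<integral>z. \<gamma> * max 0 (u x z) \<partial>M)" by simp
  also have "\<dots> \<le> (\<integral>z. \<mu> z * u x z + \<gamma> * \<eta> \<partial>M)"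
  proof (rule integral_mono)
    show "integrable M (\<lambda>z. \<gamma> * max 0 (u x z))"
      using ub[OF x] K by (intro integrable_mult_right bint[of _ K]) (auto simp: abs_le_iff)
    show "\<gamma> * max 0 (u x z) \<le> \<mu> z * u x z + \<gamma> * \<eta>" for z
      using mult_left_mono[OF hinge(3) \<gamma>, of "u x z"] by (simp add: \<mu>_def algebra_simps)
  qed (use \<mu>uint in auto)
  also have "\<dots> = (\<integral>z. \<mu> z * u x z \<partial>M) + \<gamma> * \<eta>" using \<mu>uint by (simp add: prob_space)
  finally have "av x + \<gamma> * (\<integral>z. max 0 (u x z) \<partial>M) \<le> d + \<epsilon>" using near \<eta> by linarith
  then show ?thesis using Fp by (intro exI[of _ F] exI[of _ p]) (auto simp: av_def u_def xFp)
qed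

section \<open>Bounded differences inequality\<close>

text \<open>Presenting the larger product as an image measure allows almost-everywhere statements,
  and not only integrals, to be split into the old coordinates and the new one.\<close>

lemma (in product_sigma_finite) distr_fun_upd_PiM:
  assumes I: "finite I" "i \<notin> I"
  shows "distr (Pi\<^sub>M I M \<Otimes>\<^sub>M M i) (Pi\<^sub>M (insert i I) M) (\<lambda>(f, y). f(i := y)) = Pi\<^sub>M (insert i I) M"
proof (rule PiM_eqI)
  interpret I: finite_product_sigma_finite M I by standard fact
  fix A assume A: "\<And>j. j \<in> insert i I \<Longrightarrow> A j \<in> sets (M j)"
  have *: "(\<lambda>(f, y). f(i := y)) -` Pi\<^sub>E (insert i I) A \<inter> space (Pi\<^sub>M I M \<Otimes>\<^sub>M M i) = Pi\<^sub>E I A \<times> A i"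
    using A[THEN sets.sets_into_space] I
    by (fastforce simp: space_PiM space_pair_measure PiE_iff extensional_def split: if_split_asm)
  have "Pi\<^sub>E (insert i I) A \<in> sets (Pi\<^sub>M (insert i I) M)"
    using A I by (intro sets_PiM_I_finite) auto
  then have "emeasure (distr (Pi\<^sub>M I M \<Otimes>\<^sub>M M i) (Pi\<^sub>M (insert i I) M) (\<lambda>(f, y). f(i := y))) (Pi\<^sub>E (insert i I) A)
      = emeasure (Pi\<^sub>M I M \<Otimes>\<^sub>M M i) (Pi\<^sub>E I A \<times> A i)"
    by (simp add: emeasure_distr *)
  also have "\<dots> = (\<Prod>j\<in>insert i I. emeasure (M j) (A j))"
    using A I by (simp add: M.emeasure_pair_measure_Times sets_PiM_I_finite emeasure_PiM mult.commute)
  finally show "emeasure (distr (Pi\<^sub>M I M \<Otimes>\<^sub>M M i) (Pi\<^sub>M (insert i I) M) (\<lambda>(f, y). f(i := y))) (Pi\<^sub>E (insert i I) A)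
      = (\<Prod>j\<in>insert i I. emeasure (M j) (A j))" .
qed (use I in auto)

text \<open>Hoeffding's lemma asks for one interval containing the variable, whereas here the
  oscillation is controlled only for almost all pairs. The supremum \<open>b\<close> of
  \<open>f\<close> over the points satisfying the inner almost-everywhere bound serves as right
  endpoint; it is approached along a sequence, so only countably many null sets are
  discarded.\<close>

lemma (in prob_space) AE_oscillation_imp_interval:
  fixes f :: "'a \<Rightarrow> real"
  assumes K: "\<And>x. x \<in> space M \<Longrightarrow> \<bar>f x\<bar> \<le> K"
    and osc: "AE x in M. AE y in M. f x \<le> f y + c"
  shows "\<exists>a. AE x in M. f x \<in> {a..a + c}"
proof -
  define S where "S = {x \<in> space M. AE y in M. f x \<le> f y + c}"
  have S: "AE x in M. x \<in> S" using osc AE_space by eventually_elim (simp add: S_def)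
  then have "S \<noteq> {}" using AE_False by auto
  have bdd: "bdd_above (f ` S)" using K by (intro bdd_aboveI[of _ K]) (force simp: S_def abs_le_iff)
  define b where "b = (SUP x\<in>S. f x)"
  have "AE x in M. f x \<le> b" using S by eventually_elim (simp add: b_def cSUP_upper bdd)
  moreover have "AE y in M. \<forall>k. b - 1 / real (Suc k) \<le> f y + c"
  proof (subst AE_all_countable, rule allI)
    fix k
    obtain x where "x \<in> S" "b - 1 / real (Suc k) < f x"
      using less_cSUP_iff[OF \<open>S \<noteq> {}\<close> bdd, of "b - 1 / real (Suc k)"] by (auto simp: b_def)
    then show "AE y in M. b - 1 / real (Suc k) \<le> f y + c" by (auto simp: S_def elim: eventually_mono)
  qed
  ultimately have "AE x in M. f x \<in> {b - c..b - c + c}"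
  proof eventually_elim
    case (elim y)
    have "b \<le> f y + c"
    proof (rule field_le_epsilon)
      fix e :: real assume "0 < e"
      then obtain k where "1 / real (Suc k) < e" using nat_approx_posE by blast
      with elim(2)[rule_format, of k] show "b \<le> f y + c + e" by linarith
    qed
    with elim(1) show ?case by simp
  qed
  then show ?thesis by blast
qed

text \<open>McDiarmid's exponential moment by induction on \<open>N\<close>: integrating out the
  last coordinate gives \<open>V\<close>, which inherits the difference bounds, while Hoeffding's
  lemma handles the fluctuation of \<open>U\<close> around \<open>V\<close>. The differences hold
  only for almost every \<open>s\<close>, with a null set depending on \<open>z\<close>, because the
  majorant to which this is applied is determined only up to null sets.\<close>

lemma bounded_differences_mgf:
  fixes U :: "(nat \<Rightarrow> 'a) \<Rightarrow> real"
  assumes D: "prob_space D" and l: "l > 0"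
    and U: "U \<in> borel_measurable (Pi\<^sub>M {..<N} (\<lambda>_. D))"
    and K: "\<And>s. s \<in> space (Pi\<^sub>M {..<N} (\<lambda>_. D)) \<Longrightarrow> \<bar>U s\<bar> \<le> K"
    and diff: "\<And>n z. n < N \<Longrightarrow> z \<in> space D \<Longrightarrow> AE s in Pi\<^sub>M {..<N} (\<lambda>_. D). U s \<le> U (s(n := z)) + c"
  shows "(\<integral>\<^sup>+s. exp (l * (U s - (\<integral>s. U s \<partial>Pi\<^sub>M {..<N} (\<lambda>_. D)))) \<partial>Pi\<^sub>M {..<N} (\<lambda>_. D))
      \<le> ennreal (exp (l\<^sup>2 * c\<^sup>2 * real N / 8))"
  using U K diff
proof (induction N arbitrary: U)
  case 0
  have *: "(\<integral>s. U s \<partial>Pi\<^sub>M {..<0} (\<lambda>_. D)) = U (\<lambda>_. undefined)"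
    by (simp add: PiM_empty lebesgue_integral_count_space_finite)
  show ?case unfolding * by (simp add: PiM_empty nn_integral_count_space_finite)
next
  case (Suc N)
  interpret D: prob_space D by (rule D)
  interpret P: product_prob_space "\<lambda>_. D" "{..<N}" by unfold_locales
  let ?P = "Pi\<^sub>M {..<N} (\<lambda>_. D)"
  interpret PD: pair_prob_space ?P D ..
  interpret DPD: pair_prob_space D "?P \<Otimes>\<^sub>M D" ..
  have SucN: "{..<Suc N} = insert N {..<N}" by auto
  let ?Q = "Pi\<^sub>M (insert N {..<N}) (\<lambda>_. D)"
  note U[measurable] = Suc.prems(1)[unfolded SucN]
  note K = Suc.prems(2)[unfolded SucN]
  note diff = Suc.prems(3)[unfolded SucN]
  have upd_sp: "s(N := x) \<in> space ?Q" if "s \<in> space ?P" "x \<in> space D" for s x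
    using that by (auto simp: space_PiM PiE_iff extensional_def)
  have upd[measurable]: "(\<lambda>(s, x). s(N := x)) \<in> ?P \<Otimes>\<^sub>M D \<rightarrow>\<^sub>M ?Q" by (rule measurable_add_dim)
  have Up[measurable]: "(\<lambda>w. U ((fst w)(N := snd w))) \<in> borel_measurable (?P \<Otimes>\<^sub>M D)"
    using measurable_compose[OF upd U] by (simp add: case_prod_beta')
  have Ux[measurable]: "(\<lambda>x. U (s(N := x))) \<in> borel_measurable D" if "s \<in> space ?P" for s
    using measurable_compose[OF measurable_Pair1'[OF that] Up] by simp
  define V where "V s = (\<integral>x. U (s(N := x)) \<partial>D)" for s
  have Vm[measurable]: "V \<in> borel_measurable ?P"
    unfolding V_def using D.borel_measurable_lebesgue_integral[of "\<lambda>s x. U (s(N := x))" ?P] Up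
    by (simp add: case_prod_beta')
  have Uint: "integrable D (\<lambda>x. U (s(N := x)))" if "s \<in> space ?P" for s
    using Ux[OF that] K upd_sp[OF that] by (intro D.integrable_const_bound[of _ K] AE_I2) auto
  have VK: "\<bar>V s\<bar> \<le> K" if "s \<in> space ?P" for s
  proof -
    have "\<bar>V s\<bar> \<le> (\<integral>x. \<bar>U (s(N := x))\<bar> \<partial>D)" unfolding V_def by (rule integral_abs_bound)
    also have "\<dots> \<le> (\<integral>x. K \<partial>D)" using Uint[OF that] K upd_sp[OF that] by (intro integral_mono) auto
    finally show ?thesis by (simp add: D.prob_space)
  qed
  interpret Q: prob_space ?Q by (intro prob_space_PiM D)
  have UintQ: "integrable ?Q U" using K by (intro Q.integrable_const_bound[of _ K] AE_I2) auto
  have EU: "(\<integral>s. U s \<partial>?Q) = (\<integral>s. V s \<partial>?P)"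
    unfolding V_def by (rule P.product_integral_insert[OF _ _ UintQ]) auto
  have distr_Q: "distr (?P \<Otimes>\<^sub>M D) ?Q (\<lambda>(s, x). s(N := x)) = ?Q"
    by (rule P.distr_fun_upd_PiM) auto
  have AE_split: "AE s in ?P. AE x in D. R (s(N := x))" if "AE s in ?Q. R s" for R
  proof -
    have "AE s in distr (?P \<Otimes>\<^sub>M D) ?Q (\<lambda>(s, x). s(N := x)). R s"
      unfolding distr_Q by (rule that)
    from AE_distrD[OF upd this] show ?thesis
      by (intro PD.AE_pair[of "\<lambda>w. R ((fst w)(N := snd w))", simplified]) (simp add: case_prod_beta')
  qed
  have diffV: "AE s in ?P. V s \<le> V (s(n := z)) + c" if n: "n < N" and z: "z \<in> space D" for n z
  proof -
    have "AE s in ?P. AE x in D. U (s(N := x)) \<le> U ((s(N := x))(n := z)) + c"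
      using diff[of n z] n z by (intro AE_split) auto
    then show ?thesis using AE_space
    proof eventually_elim
      case (elim s)
      have s': "s(n := z) \<in> space ?P" using elim(2) n z by (auto simp: space_PiM PiE_iff extensional_def)
      have "V s \<le> (\<integral>x. U ((s(n := z))(N := x)) + c \<partial>D)"
        unfolding V_def using Uint[OF elim(2)] Uint[OF s'] elim(1) n
        by (intro integral_mono_AE) (auto simp: fun_upd_twist)
      also have "\<dots> = V (s(n := z)) + c" using Uint[OF s'] by (simp add: V_def D.prob_space)
      finally show ?case .
    qed
  qed
  \<comment> \<open>Fubini exchanges the quantifiers: a bound for each \<open>z\<close> and almost
    all samples becomes one for almost all samples and almost all \<open>z\<close>.\<close>
  have osc: "AE s in ?P. AE x in D. AE z in D. U (s(N := x)) \<le> U (s(N := z)) + c"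
  proof -
    have "AE z in D. AE w in ?P \<Otimes>\<^sub>M D. U ((fst w)(N := snd w)) \<le> U ((fst w)(N := z)) + c"
    proof (rule AE_I2)
      fix z assume z: "z \<in> space D"
      have "AE s in distr (?P \<Otimes>\<^sub>M D) ?Q (\<lambda>(s, x). s(N := x)). U s \<le> U (s(N := z)) + c"
        unfolding distr_Q by (rule diff) (use z in auto)
      from AE_distrD[OF upd this] show "AE w in ?P \<Otimes>\<^sub>M D. U ((fst w)(N := snd w)) \<le> U ((fst w)(N := z)) + c"
        by (simp add: case_prod_beta')
    qed
    then have "AE w in ?P \<Otimes>\<^sub>M D. AE z in D. U ((fst w)(N := snd w)) \<le> U ((fst w)(N := z)) + c"
    proof (subst (asm) DPD.AE_commute)
      have "(\<lambda>x. U ((fst (snd x))(N := snd (snd x)))) \<in> borel_measurable (D \<Otimes>\<^sub>M (?P \<Otimes>\<^sub>M D))"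
        using measurable_compose[OF measurable_snd Up] by simp
      moreover have "(\<lambda>x. U ((fst (snd x))(N := fst x))) \<in> borel_measurable (D \<Otimes>\<^sub>M (?P \<Otimes>\<^sub>M D))"
        using measurable_compose[of "\<lambda>x. (fst (snd x), fst x)" "D \<Otimes>\<^sub>M (?P \<Otimes>\<^sub>M D)" "?P \<Otimes>\<^sub>M D", OF _ Up] by simp
      ultimately show "{x \<in> space (D \<Otimes>\<^sub>M (?P \<Otimes>\<^sub>M D)). U ((fst (snd x))(N := snd (snd x))) \<le> U ((fst (snd x))(N := fst x)) + c}
          \<in> sets (D \<Otimes>\<^sub>M (?P \<Otimes>\<^sub>M D))" by measurable
    qed
    from PD.AE_pair[OF this] show ?thesis by simp
  qed
  \<comment> \<open>For almost every \<open>s\<close> the last coordinate moves \<open>U\<close>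
    within an interval of length \<open>c\<close>, with mean \<open>V s\<close>.\<close>
  have inner: "AE s in ?P. (\<integral>\<^sup>+x. exp (l * (U (s(N := x)) - V s)) \<partial>D) \<le> ennreal (exp (l\<^sup>2 * c\<^sup>2 / 8))"
    using osc AE_space
  proof eventually_elim
    case (elim s)
    obtain a where "AE x in D. U (s(N := x)) \<in> {a..a + c}"
      using D.AE_oscillation_imp_interval[of "\<lambda>x. U (s(N := x))" K c] K upd_sp[OF elim(2)] elim(1) by auto
    then interpret interval_bounded_random_variable D "\<lambda>x. U (s(N := x))" a "a + c"
      by unfold_locales (use Ux[OF elim(2)] in auto)
    show ?case using Hoeffdings_lemma_nn_integral[OF l] by (simp add: V_def)
  qed
  have "(\<integral>\<^sup>+s. exp (l * (U s - (\<integral>s. V s \<partial>?P))) \<partial>?Q) =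
      (\<integral>\<^sup>+s. \<integral>\<^sup>+x. exp (l * (U (s(N := x)) - (\<integral>s. V s \<partial>?P))) \<partial>D \<partial>?P)"
    by (subst P.product_nn_integral_insert) auto
  also have "\<dots> = (\<integral>\<^sup>+s. ennreal (exp (l * (V s - (\<integral>s. V s \<partial>?P)))) * (\<integral>\<^sup>+x. exp (l * (U (s(N := x)) - V s)) \<partial>D) \<partial>?P)"
  proof (rule nn_integral_cong)
    fix s assume s: "s \<in> space ?P"
    have "(\<integral>\<^sup>+x. exp (l * (U (s(N := x)) - (\<integral>s. V s \<partial>?P))) \<partial>D) =
       (\<integral>\<^sup>+x. ennreal (exp (l * (V s - (\<integral>s. V s \<partial>?P)))) * ennreal (exp (l * (U (s(N := x)) - V s))) \<partial>D)"
      by (intro nn_integral_cong) (simp add: ennreal_mult'[symmetric] exp_add[symmetric] algebra_simps)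
    also have "\<dots> = ennreal (exp (l * (V s - (\<integral>s. V s \<partial>?P)))) * (\<integral>\<^sup>+x. exp (l * (U (s(N := x)) - V s)) \<partial>D)"
      using Ux[OF s] by (intro nn_integral_cmult) auto
    finally show "(\<integral>\<^sup>+x. exp (l * (U (s(N := x)) - (\<integral>s. V s \<partial>?P))) \<partial>D) = \<dots>" .
  qed
  also have "\<dots> \<le> (\<integral>\<^sup>+s. ennreal (exp (l * (V s - (\<integral>s. V s \<partial>?P)))) * ennreal (exp (l\<^sup>2 * c\<^sup>2 / 8)) \<partial>?P)"
  proof (rule nn_integral_mono_AE)
    show "AE s in ?P. ennreal (exp (l * (V s - (\<integral>s. V s \<partial>?P)))) * (\<integral>\<^sup>+x. exp (l * (U (s(N := x)) - V s)) \<partial>D)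
        \<le> ennreal (exp (l * (V s - (\<integral>s. V s \<partial>?P)))) * ennreal (exp (l\<^sup>2 * c\<^sup>2 / 8))"
      using inner by eventually_elim (rule mult_left_mono, auto)
  qed
  also have "\<dots> = (\<integral>\<^sup>+s. exp (l * (V s - (\<integral>s. V s \<partial>?P))) \<partial>?P) * ennreal (exp (l\<^sup>2 * c\<^sup>2 / 8))"
    by (intro nn_integral_multc) auto
  also have "\<dots> \<le> ennreal (exp (l\<^sup>2 * c\<^sup>2 * real N / 8)) * ennreal (exp (l\<^sup>2 * c\<^sup>2 / 8))"
    by (intro mult_right_mono Suc.IH[OF Vm VK diffV]) auto
  also have "\<dots> = ennreal (exp (l\<^sup>2 * c\<^sup>2 * real (Suc N) / 8))"
    by (simp add: ennreal_mult'[symmetric] exp_add[symmetric] algebra_simps add_divide_distrib)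
  finally show ?case unfolding SucN EU .
qed

text \<open>Serves both concentration steps: for the majorant of the uniform deviation, and for an
  average of bounded independent terms, where it amounts to Hoeffding's inequality.\<close>

lemma bounded_differences_tail:
  fixes U :: "(nat \<Rightarrow> 'a) \<Rightarrow> real"
  assumes D: "prob_space D" and N: "N > 0" and c: "c > 0" and t: "t > 0"
    and U[measurable]: "U \<in> borel_measurable (Pi\<^sub>M {..<N} (\<lambda>_. D))"
    and K: "\<And>s. s \<in> space (Pi\<^sub>M {..<N} (\<lambda>_. D)) \<Longrightarrow> \<bar>U s\<bar> \<le> K"
    and diff: "\<And>n z. n < N \<Longrightarrow> z \<in> space D \<Longrightarrow> AE s in Pi\<^sub>M {..<N} (\<lambda>_. D). U s \<le> U (s(n := z)) + c"
    and E: "(\<integral>s. U s \<partial>Pi\<^sub>M {..<N} (\<lambda>_. D)) \<le> m"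
  shows "1 - exp (- 2 * t\<^sup>2 / (real N * c\<^sup>2)) \<le>
    measure (Pi\<^sub>M {..<N} (\<lambda>_. D)) {s \<in> space (Pi\<^sub>M {..<N} (\<lambda>_. D)). U s \<le> m + t}"
proof -
  let ?P = "Pi\<^sub>M {..<N} (\<lambda>_. D)"
  interpret P: prob_space ?P by (intro prob_space_PiM D)
  \<comment> \<open>This value minimizes the exponent
    \<open>- l * t + l^2 * c^2 * N / 8\<close>.\<close>
  define l where "l = 4 * t / (real N * c\<^sup>2)"
  have l: "l > 0" using N c t by (simp add: l_def)
  let ?W = "\<lambda>s. U s - (\<integral>s. U s \<partial>?P)"
  have "emeasure ?P {s \<in> space ?P. ?W s \<ge> t} \<le> ennreal (exp (- l * t)) * (\<integral>\<^sup>+s. ennreal (exp (l * ?W s)) * indicator (space ?P) s \<partial>?P)"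
    using l by (intro Chernoff_ineq_nn_integral_ge) auto
  also have "(\<integral>\<^sup>+s. ennreal (exp (l * ?W s)) * indicator (space ?P) s \<partial>?P) = (\<integral>\<^sup>+s. exp (l * ?W s) \<partial>?P)"
    by (intro nn_integral_cong) auto
  also have "ennreal (exp (- l * t)) * \<dots> \<le> ennreal (exp (- l * t)) * ennreal (exp (l\<^sup>2 * c\<^sup>2 * real N / 8))"
    by (intro mult_left_mono bounded_differences_mgf[OF D l U K diff]) auto
  also have "\<dots> = ennreal (exp (- 2 * t\<^sup>2 / (real N * c\<^sup>2)))"
    using N c by (simp add: ennreal_mult'[symmetric] exp_add[symmetric] l_def) (simp add: field_simps power2_eq_square)
  finally have *: "P.prob {s \<in> space ?P. ?W s \<ge> t} \<le> exp (- 2 * t\<^sup>2 / (real N * c\<^sup>2))"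
    by (simp add: P.emeasure_eq_measure)
  have "1 - P.prob {s \<in> space ?P. ?W s \<ge> t} = P.prob {s \<in> space ?P. \<not> ?W s \<ge> t}"
    by (subst P.prob_neg) auto
  also have "\<dots> \<le> P.prob {s \<in> space ?P. U s \<le> m + t}"
    using E by (intro P.finite_measure_mono) auto
  finally show ?thesis using * by linarith
qed

section \<open>Uniform deviation of a weighted class\<close>

text \<open>A measurable majorant of least integral is minimal almost everywhere: cutting it down by
  another majorant \<open>V\<close> cannot lower its integral, so \<open>min U V = U\<close> almost
  everywhere. The least integral is attained by the countable infimum of a minimizing
  sequence.\<close>

lemma (in prob_space) minimal_measurable_majorant:
  fixes \<Phi> :: "'a \<Rightarrow> real"
  assumes K: "\<And>x. x \<in> space M \<Longrightarrow> \<bar>\<Phi> x\<bar> \<le> K"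
  obtains U where "U \<in> borel_measurable M" "\<And>x. x \<in> space M \<Longrightarrow> \<Phi> x \<le> U x"
    "\<And>x. x \<in> space M \<Longrightarrow> \<bar>U x\<bar> \<le> K"
    "\<And>V. V \<in> borel_measurable M \<Longrightarrow> (\<And>x. x \<in> space M \<Longrightarrow> \<Phi> x \<le> V x) \<Longrightarrow> AE x in M. U x \<le> V x"
proof -
  define \<U> where "\<U> = {U \<in> borel_measurable M. \<forall>x\<in>space M. \<Phi> x \<le> U x \<and> \<bar>U x\<bar> \<le> K}"
  have int: "integrable M U" if "U \<in> \<U>" for U
    using that by (intro integrable_const_bound[of _ K] AE_I2) (auto simp: \<U>_def)
  have K0: "0 \<le> K" using K not_empty by (meson abs_ge_zero ex_in_conv order_trans)
  have "(\<lambda>_. K) \<in> \<U>" using K K0 by (auto simp: \<U>_def abs_le_iff)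
  then have ne: "\<U> \<noteq> {}" by blast
  have lower: "- K \<le> (\<integral>x. U x \<partial>M)" if "U \<in> \<U>" for U
  proof -
    have "(\<integral>x. - K \<partial>M) \<le> (\<integral>x. U x \<partial>M)"
      using int[OF that] that by (intro integral_mono) (auto simp: \<U>_def abs_le_iff minus_le_iff)
    then show ?thesis by (simp add: prob_space)
  qed
  then have bdd: "bdd_below ((\<lambda>U. \<integral>x. U x \<partial>M) ` \<U>)" by (intro bdd_belowI[of _ "- K"]) auto
  define m where "m = (INF U\<in>\<U>. \<integral>x. U x \<partial>M)"
  have "\<exists>U\<in>\<U>. (\<integral>x. U x \<partial>M) < m + 1 / real (Suc k)" for k
    using cINF_less_iff[OF ne bdd, of "m + 1 / real (Suc k)"] unfolding m_def[symmetric] by simp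
  then obtain u where u: "\<And>k. u k \<in> \<U>" and um: "\<And>k. (\<integral>x. u k x \<partial>M) < m + 1 / real (Suc k)" by metis
  have bddu: "bdd_below (range (\<lambda>k. u k x))" if "x \<in> space M" for x
  proof (rule bdd_belowI[of _ "- K"])
    fix y assume "y \<in> range (\<lambda>k. u k x)"
    then obtain k where "y = u k x" by blast
    moreover have "\<bar>u k x\<bar> \<le> K" using u[of k] that by (auto simp: \<U>_def)
    ultimately show "- K \<le> y" by linarith
  qed
  define U where "U x = (INF k. u k x)" for x
  have U_le: "U x \<le> u k x" if "x \<in> space M" for x k
    unfolding U_def using bddu[OF that] by (intro cINF_lower) auto
  have [measurable]: "U \<in> borel_measurable M"
    unfolding U_def using u bddu by (intro borel_measurable_cINF) (auto simp: \<U>_def)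
  have U_ge: "\<Phi> x \<le> U x" if "x \<in> space M" for x
    unfolding U_def using u that by (intro cINF_greatest) (auto simp: \<U>_def)
  have U_abs: "\<bar>U x\<bar> \<le> K" if x: "x \<in> space M" for x
  proof -
    have "u 0 x \<le> K" using u[of 0] x by (auto simp: \<U>_def)
    then show ?thesis using U_ge[OF x] K[OF x] U_le[OF x, of 0] by linarith
  qed
  have UU: "U \<in> \<U>" using U_ge U_abs by (simp add: \<U>_def)
  have "(\<integral>x. U x \<partial>M) \<le> m"
  proof (rule field_le_epsilon)
    fix e :: real assume "0 < e"
    then obtain k where "1 / real (Suc k) < e" using nat_approx_posE by blast
    moreover have "(\<integral>x. U x \<partial>M) \<le> (\<integral>x. u k x \<partial>M)"
      using int[OF UU] int[OF u] U_le by (intro integral_mono) auto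
    ultimately show "(\<integral>x. U x \<partial>M) \<le> m + e" using um[of k] by linarith
  qed
  moreover have "AE x in M. U x \<le> V x"
    if [measurable]: "V \<in> borel_measurable M" and V: "\<And>x. x \<in> space M \<Longrightarrow> \<Phi> x \<le> V x" 
      and m: "(\<integral>x. U x \<partial>M) \<le> m" for V
  proof -
    let ?W = "\<lambda>x. min (U x) (V x)"
    have "\<bar>?W x\<bar> \<le> K" if x: "x \<in> space M" for x
      using U_abs[OF x] V[OF x] U_ge[OF x] K[OF x] by (auto simp: abs_le_iff)
    then have W: "?W \<in> \<U>" using V U_ge by (simp add: \<U>_def)
    have "m \<le> (\<integral>x. ?W x \<partial>M)" unfolding m_def using bdd W by (rule cINF_lower)
    moreover have "(\<integral>x. ?W x \<partial>M) \<le> (\<integral>x. U x \<partial>M)"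
      using int[OF W] int[OF UU] by (intro integral_mono) auto
    ultimately have "(\<integral>x. U x - ?W x \<partial>M) = 0"
      using int[OF W] int[OF UU] m by (simp)
    moreover have "integrable M (\<lambda>x. U x - ?W x)" using int[OF W] int[OF UU] by simp
    ultimately have "AE x in M. U x - ?W x = 0"
      by (subst (asm) integral_nonneg_eq_0_iff_AE) auto
    then show ?thesis by eventually_elim auto
  qed
  ultimately show thesis using U_ge U_abs by (intro that[of U]) auto
qed

text \<open>On a null set containing the points where \<open>V\<close> differs from a Borel version,
  the version is raised to the bound \<open>K\<close>. The majorant then holds everywhere at no cost
  in the integral, and Borel measurability survives the later composition with maps between product
  spaces.\<close>

lemma borel_majorant_of_completion:
  fixes V :: "'a \<Rightarrow> real"
  assumes V: "V \<in> borel_measurable (completion M)" and K: "\<And>x. x \<in> space M \<Longrightarrow> \<bar>V x\<bar> \<le> K"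
  obtains V' where "V' \<in> borel_measurable M" "\<And>x. x \<in> space M \<Longrightarrow> V x \<le> V' x"
    "\<And>x. x \<in> space M \<Longrightarrow> \<bar>V' x\<bar> \<le> K" "(\<integral>x. V' x \<partial>M) = (\<integral>x. V x \<partial>completion M)"
proof -
  obtain g where g[measurable]: "g \<in> borel_measurable M" and ae: "AE x in M. V x = g x"
    using completion_ex_borel_measurable_real[OF V] by blast
  obtain N where N: "{x \<in> space M. V x \<noteq> g x} \<subseteq> N" "N \<in> null_sets M"
    using ae by (auto elim!: AE_E simp: null_sets_def)
  define V' where "V' x = (if x \<in> N then K else g x)" for x
  have [measurable]: "N \<in> sets M" using N by auto
  have m[measurable]: "V' \<in> borel_measurable M" unfolding V'_def by measurable
  have gV: "g x = V x" if "x \<in> space M" "x \<notin> N" for x using N that by auto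
  have K': "\<bar>V' x\<bar> \<le> K" if "x \<in> space M" for x
    using K[OF that] gV[OF that] by (auto simp: V'_def)
  have "AE x in M. V' x = V x"
    using AE_not_in[OF N(2)] AE_space by eventually_elim (auto simp: V'_def gV)
  then have "(\<integral>x. V x \<partial>completion M) = (\<integral>x. V' x \<partial>completion M)"
    using V measurable_completion[OF m]
    by (intro integral_cong_AE AE_completion) (auto elim: eventually_mono)
  also have "\<dots> = (\<integral>x. V' x \<partial>M)" using m by (rule integral_completion)
  finally have "(\<integral>x. V' x \<partial>M) = (\<integral>x. V x \<partial>completion M)" by simp
  moreover have "V x \<le> V' x" if "x \<in> space M" for x
    using K[OF that] gV[OF that] by (auto simp: V'_def)
  ultimately show thesis using m K' by (intro that[of V']) auto
qed

text \<open>The invariance behind symmetrization: for a fixed pattern \<open>b\<close>, a sample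
  assembled coordinatewise from two independent ones has the same law again.\<close>

lemma (in product_prob_space) distr_PiM_mix:
  assumes I: "finite I"
  shows "distr (Pi\<^sub>M I M \<Otimes>\<^sub>M Pi\<^sub>M I M) (Pi\<^sub>M I M) (\<lambda>(x, y). \<lambda>i\<in>I. if b i then y i else x i) = Pi\<^sub>M I M"
    (is "distr (?P \<Otimes>\<^sub>M ?P) ?P ?f = ?P")
proof (rule PiM_eqI)
  fix A assume A: "\<And>i. i \<in> I \<Longrightarrow> A i \<in> sets (M i)"
  let ?A1 = "Pi\<^sub>E I (\<lambda>i. if b i then space (M i) else A i)"
  let ?A2 = "Pi\<^sub>E I (\<lambda>i. if b i then A i else space (M i))"
  have f[measurable]: "?f \<in> ?P \<Otimes>\<^sub>M ?P \<rightarrow>\<^sub>M ?P"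
    unfolding case_prod_beta' by (intro measurable_restrict) (auto intro!: measurable_If)
  have *: "?f -` Pi\<^sub>E I A \<inter> space (?P \<Otimes>\<^sub>M ?P) = ?A1 \<times> ?A2"
  proof (rule set_eqI)
    fix w
    show "w \<in> ?f -` Pi\<^sub>E I A \<inter> space (?P \<Otimes>\<^sub>M ?P) \<longleftrightarrow> w \<in> ?A1 \<times> ?A2"
      using A[THEN sets.sets_into_space]
      by (cases w) (auto simp: space_PiM space_pair_measure PiE_iff subset_iff split: if_split_asm)
  qed
  have "Pi\<^sub>E I A \<in> sets ?P" using A I by (intro sets_PiM_I_finite) auto
  then have "emeasure (distr (?P \<Otimes>\<^sub>M ?P) ?P ?f) (Pi\<^sub>E I A) = emeasure (?P \<Otimes>\<^sub>M ?P) (?A1 \<times> ?A2)"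
    by (simp add: emeasure_distr *)
  also have "\<dots> = emeasure ?P ?A1 * emeasure ?P ?A2"
    using A I by (intro P.emeasure_pair_measure_Times sets_PiM_I_finite) auto
  also have "\<dots> = (\<Prod>i\<in>I. emeasure (M i) (if b i then space (M i) else A i)) *
      (\<Prod>i\<in>I. emeasure (M i) (if b i then A i else space (M i)))"
    using A I by (subst (1 2) emeasure_PiM) auto
  also have "\<dots> = (\<Prod>i\<in>I. emeasure (M i) (A i))"
    unfolding prod.distrib[symmetric] by (intro prod.cong) (auto simp: M.emeasure_space_1)
  finally show "emeasure (distr (?P \<Otimes>\<^sub>M ?P) ?P ?f) (Pi\<^sub>E I A) = (\<Prod>i\<in>I. emeasure (M i) (A i))" .
qed (use I in auto)

text \<open>The distributive law for sign vectors in the form in which \<open>Pi_pmf\<close>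
  delivers them, with a default value off the index set.\<close>

lemma prod_sum_PiE_dflt:
  fixes f :: "'a \<Rightarrow> 'b \<Rightarrow> 'c :: comm_semiring_1"
  assumes "finite A" "\<And>x. x \<in> A \<Longrightarrow> finite (B x)"
  shows "(\<Sum>g\<in>PiE_dflt A d B. \<Prod>x\<in>A. f x (g x)) = (\<Prod>x\<in>A. \<Sum>y\<in>B x. f x y)"
proof -
  have "inj_on (\<lambda>h x. if x \<in> A then h x else d) (PiE A B)"
  proof (rule inj_onI)
    fix g h assume gh: "g \<in> PiE A B" "h \<in> PiE A B"
      and eq: "(\<lambda>x. if x \<in> A then g x else d) = (\<lambda>x. if x \<in> A then h x else d)"
    show "g = h"
    proof (rule PiE_ext[OF gh])
      show "g x = h x" if "x \<in> A" for x using fun_cong[OF eq, of x] that by simp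
    qed
  qed
  then have "(\<Sum>g\<in>PiE_dflt A d B. \<Prod>x\<in>A. f x (g x)) = (\<Sum>g\<in>PiE A B. \<Prod>x\<in>A. f x (g x))"
    unfolding dflt_image_PiE[of A d B, symmetric]
    by (subst sum.reindex) (auto intro!: sum.cong prod.cong)
  then show ?thesis using assms by (simp add: prod_sum_PiE)
qed

text \<open>Contraction without loss: \<open>R\<close> is the Rademacher average of the unweighted
  class, yet the bound holds for the weighted one. The condition \<open>lo \<le> 0 \<le> hi\<close>
  keeps weighted values inside \<open>[lo, hi]\<close>, so the bounded differences do not
  deteriorate either. One side suffices, because the weight enters only the lower estimate of the
  empirical value.\<close>

lemma weighted_uniform_deviation:
  fixes h :: "'i \<Rightarrow> 'z \<Rightarrow> real" and w :: "'z \<Rightarrow> real" and H :: "'i set" and N :: nat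
  defines "signs \<equiv> PiE_dflt {..<N} 0 (\<lambda>_. {-1, 1 :: real})"
  defines "rad \<sigma> s \<equiv> (SUP f\<in>H. \<Sum>n<N. \<sigma> n * h f (s n))"
  assumes D: "prob_space D" and N: "N > 0" and H: "H \<noteq> {}"
    and h[measurable]: "\<And>f. f \<in> H \<Longrightarrow> h f \<in> borel_measurable D"
    and h_range: "\<And>f z. f \<in> H \<Longrightarrow> z \<in> space D \<Longrightarrow> h f z \<in> {lo..hi}"
    and lo: "lo \<le> 0" "0 \<le> hi" "lo < hi"
    and w[measurable]: "w \<in> borel_measurable D" and w01: "\<And>z. z \<in> space D \<Longrightarrow> w z \<in> {0..1}"
    and rad: "\<And>\<sigma>. \<sigma> \<in> signs \<Longrightarrow> integrable (completion (Pi\<^sub>M {..<N} (\<lambda>_. D))) (rad \<sigma>)"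
    and t: "t > 0"
  defines "R \<equiv> (\<Sum>\<sigma>\<in>signs. \<integral>s. rad \<sigma> s \<partial>completion (Pi\<^sub>M {..<N} (\<lambda>_. D))) / real (card signs) / real N"
  shows "\<exists>A\<in>sets (Pi\<^sub>M {..<N} (\<lambda>_. D)).
      1 - exp (- 2 * real N * t\<^sup>2 / (hi - lo)\<^sup>2) \<le> measure (Pi\<^sub>M {..<N} (\<lambda>_. D)) A \<and>
      (\<forall>s\<in>A. \<forall>f\<in>H. (\<integral>z. w z * h f z \<partial>D) - (\<Sum>n<N. w (s n) * h f (s n)) / real N \<le> 2 * R + t)"
proof -
  let ?P = "Pi\<^sub>M {..<N} (\<lambda>_. D)"
  interpret D: prob_space D by (rule D)
  interpret P: product_prob_space "\<lambda>_. D" "{..<N}" by unfold_locales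
  interpret PP: pair_prob_space ?P ?P ..
  define K where "K = max \<bar>lo\<bar> \<bar>hi\<bar>"
  have K: "\<bar>h f z\<bar> \<le> K" if "f \<in> H" "z \<in> space D" for f z
    using h_range[OF that] by (auto simp: K_def)
  have whK: "\<bar>w z * h f z\<bar> \<le> K" if "f \<in> H" "z \<in> space D" for f z
    using w01[OF that(2)] K[OF that] mult_mono[of "\<bar>w z\<bar>" 1 "\<bar>h f z\<bar>" K] by (simp add: abs_mult)
  have wh_osc: "w z * h f z - w z' * h f z' \<le> hi - lo" if "f \<in> H" "z \<in> space D" "z' \<in> space D" for f z z'
  proof -
    have scale: "u * x \<le> y" if "0 \<le> u" "u \<le> 1" "x \<le> y" "0 \<le> y" for u x y :: real
      using mult_right_mono[of x y u] mult_left_le_one_le[of y u] that by (simp add: mult.commute)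
    have "w z * h f z \<le> hi"
      using w01[OF that(2)] h_range[OF that(1,2)] lo by (intro scale) auto
    moreover have "w z' * (- h f z') \<le> - lo"
      using w01[OF that(3)] h_range[OF that(1,3)] lo by (intro scale) auto
    ultimately show ?thesis by simp
  qed
  have s_sp: "s n \<in> space D" if "s \<in> space ?P" "n < N" for s n
    using that by (auto simp: space_PiM PiE_iff)
  have comp[measurable]: "(\<lambda>s. s n) \<in> ?P \<rightarrow>\<^sub>M D" if "n < N" for n
    using that by (intro measurable_component_singleton) auto
  have fin_signs: "finite (signs)" unfolding signs_def by (intro finite_PiE_dflt) auto
  have signs_val: "\<sigma> n = -1 \<or> \<sigma> n = 1" if "\<sigma> \<in> signs" "n < N" for \<sigma> n
    using that by (auto simp: signs_def PiE_dflt_def)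
  have signs_mult: "(\<lambda>n. \<sigma> n * \<tau> n) \<in> signs" if "\<sigma> \<in> signs" "\<tau> \<in> signs" for \<sigma> \<tau>
    using that unfolding signs_def PiE_dflt_def by fastforce
  have signs_neg: "(\<lambda>n. - \<sigma> n) \<in> signs" if "\<sigma> \<in> signs" for \<sigma>
    using that by (auto simp: signs_def PiE_dflt_def)
  have "(\<lambda>n. if n < N then 1 else 0) \<in> signs" by (auto simp: signs_def PiE_dflt_def)
  then have card_signs: "0 < card signs" using fin_signs by (auto simp: card_gt_0_iff)

  \<comment> \<open>Bounds on the unweighted Rademacher suprema\<close>
  have sumK: "\<bar>\<Sum>n<N. \<sigma> n * h f (s n)\<bar> \<le> N * K" if "\<sigma> \<in> signs" "f \<in> H" "s \<in> space ?P" for \<sigma> f s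
  proof -
    have "\<bar>\<Sum>n<N. \<sigma> n * h f (s n)\<bar> \<le> (\<Sum>n<N. \<bar>\<sigma> n * h f (s n)\<bar>)" by (rule sum_abs)
    also have "\<dots> \<le> (\<Sum>n<N. K)"
      using signs_val[OF that(1)] K[OF that(2) s_sp[OF that(3)]]
      by (intro sum_mono) (fastforce simp: abs_mult)
    finally show ?thesis by simp
  qed
  have rad_upper: "(\<Sum>n<N. \<sigma> n * h f (s n)) \<le> rad \<sigma> s" if "\<sigma> \<in> signs" "f \<in> H" "s \<in> space ?P" for \<sigma> f s
    unfolding rad_def using sumK[OF that(1) _ that(3)] that(2)
    by (intro cSUP_upper bdd_aboveI[of _ "N * K"]) (auto simp: abs_le_iff)
  have rad_abs: "\<bar>rad \<sigma> s\<bar> \<le> N * K" if "\<sigma> \<in> signs" "s \<in> space ?P" for \<sigma> s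
  proof -
    obtain f where f: "f \<in> H" using H by blast
    have "rad \<sigma> s \<le> N * K"
      unfolding rad_def using sumK[OF that(1) _ that(2)] H by (intro cSUP_least) (auto simp: abs_le_iff)
    moreover have "- (N * K) \<le> rad \<sigma> s" using rad_upper[OF that(1) f that(2)] sumK[OF that(1) f that(2)] by linarith
    ultimately show ?thesis by linarith
  qed

  \<comment> \<open>A weight in \<open>[0, 1]\<close> is the mean of a random sign, so convexity of the supremum bounds the
    weighted sum by a \<open>W\<close>-average of unweighted ones.\<close>
  define W where "W \<tau> s = (\<Prod>n<N. (1 + \<tau> n * w (s n)) / 2)" for \<tau> :: "nat \<Rightarrow> real" and s
  have Wm[measurable]: "W \<tau> \<in> borel_measurable ?P" for \<tau>
    unfolding W_def[abs_def] by measurable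
  have W01: "0 \<le> W \<tau> s" "W \<tau> s \<le> 1" if "\<tau> \<in> signs" "s \<in> space ?P" for \<tau> s
  proof -
    have "0 \<le> (1 + \<tau> n * w (s n)) / 2 \<and> (1 + \<tau> n * w (s n)) / 2 \<le> 1" if "n < N" for n
      using signs_val[OF \<open>\<tau> \<in> signs\<close> that] w01[OF s_sp[OF \<open>s \<in> space ?P\<close> that]] by auto
    then show "0 \<le> W \<tau> s" "W \<tau> s \<le> 1" unfolding W_def by (auto intro!: prod_nonneg prod_le_1)
  qed
  have W_sum: "(\<Sum>\<tau>\<in>signs. W \<tau> s) = 1" for s
    unfolding W_def signs_def
    by (subst prod_sum_PiE_dflt[of "{..<N}" "\<lambda>_. {-1, 1}" "\<lambda>n y. (1 + y * w (s n)) / 2" 0])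
      (auto simp: field_simps)
  have W_mean: "(\<Sum>\<tau>\<in>signs. W \<tau> s * \<tau> k) = w (s k)" if k: "k < N" for s k
  proof -
    \<comment> \<open>The extra sign is absorbed as a factor at \<open>n = k\<close>, so that the
      sum over sign vectors factorizes; all other factors sum to 1.\<close>
    have "(\<Sum>\<tau>\<in>signs. W \<tau> s * \<tau> k) =
        (\<Sum>\<tau>\<in>signs. \<Prod>n<N. (1 + \<tau> n * w (s n)) / 2 * (if n = k then \<tau> n else 1))"
      unfolding W_def prod.distrib using k by (intro sum.cong) auto
    also have "\<dots> = (\<Prod>n<N. \<Sum>y\<in>{-1, 1}. (1 + y * w (s n)) / 2 * (if n = k then y else 1))"
      unfolding signs_def
      by (subst prod_sum_PiE_dflt[of "{..<N}" "\<lambda>_. {-1, 1}" "\<lambda>n y. (1 + y * w (s n)) / 2 * (if n = k then y else 1)" 0]) auto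
    also have "\<dots> = (\<Prod>n<N. if n = k then w (s k) else 1)"
      by (intro prod.cong) (auto simp: field_simps)
    also have "\<dots> = w (s k)" using k by simp
    finally show ?thesis .
  qed

  \<comment> \<open>The sign vector \<tau> replaces the weights and merges with \<sigma>, since
    products of sign vectors are sign vectors.\<close>
  define V where "V \<sigma> s = (\<Sum>\<tau>\<in>signs. W \<tau> s * rad (\<lambda>n. \<sigma> n * \<tau> n) s)" for \<sigma> s
  have V_upper: "(\<Sum>n<N. \<sigma> n * (w (s n) * h f (s n))) \<le> V \<sigma> s"
    if "\<sigma> \<in> signs" "f \<in> H" "s \<in> space ?P" for \<sigma> f s
  proof -
    have "(\<Sum>n<N. \<sigma> n * (w (s n) * h f (s n))) = (\<Sum>n<N. \<Sum>\<tau>\<in>signs. W \<tau> s * (\<sigma> n * \<tau> n * h f (s n)))"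
      by (intro sum.cong refl) (simp add: W_mean[symmetric] sum_distrib_right sum_distrib_left mult_ac)
    also have "\<dots> = (\<Sum>\<tau>\<in>signs. W \<tau> s * (\<Sum>n<N. \<sigma> n * \<tau> n * h f (s n)))"
      by (subst sum.swap) (simp add: sum_distrib_left)
    also have "\<dots> \<le> V \<sigma> s"
      unfolding V_def using rad_upper[OF signs_mult[OF that(1)] that(2,3)] W01[OF _ that(3)]
      by (intro sum_mono mult_left_mono) auto
    finally show ?thesis .
  qed
  have V_abs: "\<bar>V \<sigma> s\<bar> \<le> N * K" if "\<sigma> \<in> signs" "s \<in> space ?P" for \<sigma> s
  proof -
    have "\<bar>V \<sigma> s\<bar> \<le> (\<Sum>\<tau>\<in>signs. \<bar>W \<tau> s * rad (\<lambda>n. \<sigma> n * \<tau> n) s\<bar>)" unfolding V_def by (rule sum_abs)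
    also have "\<dots> \<le> (\<Sum>\<tau>\<in>signs. W \<tau> s * (N * K))"
      using rad_abs[OF signs_mult[OF that(1)] that(2)] W01[OF _ that(2)]
      by (intro sum_mono) (auto simp: abs_mult intro!: mult_left_mono)
    also have "\<dots> = N * K" by (simp add: sum_distrib_right[symmetric] W_sum)
    finally show ?thesis .
  qed
  have Wrad_int: "integrable (completion ?P) (\<lambda>s. W \<tau> s * rad \<sigma> s)" if "\<sigma> \<in> signs" "\<tau> \<in> signs" for \<sigma> \<tau>
  proof (rule Bochner_Integration.integrable_bound[OF rad[OF that(1)]])
    show "(\<lambda>s. W \<tau> s * rad \<sigma> s) \<in> borel_measurable (completion ?P)"
      using borel_measurable_integrable[OF rad[OF that(1)]]
      by (intro borel_measurable_times measurable_completion[OF Wm])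
    show "AE s in completion ?P. norm (W \<tau> s * rad \<sigma> s) \<le> norm (rad \<sigma> s)"
      using W01[OF that(2)] by (intro AE_I2) (auto simp: abs_mult intro!: mult_left_le_one_le)
  qed
  have V_int: "integrable (completion ?P) (V \<sigma>)" if "\<sigma> \<in> signs" for \<sigma>
    unfolding V_def using Wrad_int[OF signs_mult[OF that]] by (intro Bochner_Integration.integrable_sum) auto
  \<comment> \<open>Multiplication by a fixed \<tau> permutes the sign vectors, so summing over
    \<sigma> removes \<tau>, and then the \<open>W\<close> sum to 1: the dependence on
    \<open>w\<close> disappears.\<close>
  have V_sum: "(\<Sum>\<sigma>\<in>signs. V \<sigma> s) = (\<Sum>\<sigma>\<in>signs. rad \<sigma> s)" for s
  proof -
    have "(\<Sum>\<sigma>\<in>signs. V \<sigma> s) = (\<Sum>\<tau>\<in>signs. W \<tau> s * (\<Sum>\<sigma>\<in>signs. rad (\<lambda>n. \<sigma> n * \<tau> n) s))"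
      unfolding V_def by (subst sum.swap) (simp add: sum_distrib_left)
    also have "\<dots> = (\<Sum>\<tau>\<in>signs. W \<tau> s * (\<Sum>\<sigma>\<in>signs. rad \<sigma> s))"
    proof (rule sum.cong[OF refl], rule arg_cong[where f="\<lambda>x. W _ s * x"])
      fix \<tau> assume \<tau>: "\<tau> \<in> signs"
      have inv: "(\<lambda>n. (\<sigma> n * \<tau> n) * \<tau> n) = \<sigma>" if "\<sigma> \<in> signs" for \<sigma>
        using that \<tau> by (auto simp: signs_def PiE_dflt_def fun_eq_iff)
      show "(\<Sum>\<sigma>\<in>signs. rad (\<lambda>n. \<sigma> n * \<tau> n) s) = (\<Sum>\<sigma>\<in>signs. rad \<sigma> s)"
        by (rule sum.reindex_bij_witness[where i="\<lambda>\<sigma> n. \<sigma> n * \<tau> n" and j="\<lambda>\<sigma> n. \<sigma> n * \<tau> n"])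
          (use \<tau> in \<open>auto simp: inv signs_mult\<close>)
    qed
    also have "\<dots> = (\<Sum>\<sigma>\<in>signs. rad \<sigma> s)" by (simp add: sum_distrib_right[symmetric] W_sum)
    finally show ?thesis .
  qed
  have V_sum_int: "(\<Sum>\<sigma>\<in>signs. \<integral>s. V \<sigma> s \<partial>completion ?P) = R * real (card signs) * real N"
  proof -
    have "(\<Sum>\<sigma>\<in>signs. \<integral>s. V \<sigma> s \<partial>completion ?P) = (\<integral>s. (\<Sum>\<sigma>\<in>signs. V \<sigma> s) \<partial>completion ?P)"
      using V_int by (subst Bochner_Integration.integral_sum) auto
    also have "\<dots> = (\<Sum>\<sigma>\<in>signs. \<integral>s. rad \<sigma> s \<partial>completion ?P)"
      unfolding V_sum using rad by (subst Bochner_Integration.integral_sum) auto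
    finally show ?thesis using card_signs N by (simp add: R_def)
  qed
  have "\<exists>V'. V' \<in> borel_measurable ?P \<and> (\<forall>s\<in>space ?P. V \<sigma> s \<le> V' s \<and> \<bar>V' s\<bar> \<le> N * K) \<and>
      (\<integral>s. V' s \<partial>?P) = (\<integral>s. V \<sigma> s \<partial>completion ?P)" if "\<sigma> \<in> signs" for \<sigma>
  proof -
    have m: "V \<sigma> \<in> borel_measurable (completion ?P)"
      using V_int[OF that] by (rule borel_measurable_integrable)
    show ?thesis
      using borel_majorant_of_completion[OF m V_abs[OF that]] by metis
  qed
  then obtain V' where V'm: "\<And>\<sigma>. \<sigma> \<in> signs \<Longrightarrow> V' \<sigma> \<in> borel_measurable ?P"
    and V'_ge: "\<And>\<sigma> s. \<sigma> \<in> signs \<Longrightarrow> s \<in> space ?P \<Longrightarrow> V \<sigma> s \<le> V' \<sigma> s"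
    and V'_abs: "\<And>\<sigma> s. \<sigma> \<in> signs \<Longrightarrow> s \<in> space ?P \<Longrightarrow> \<bar>V' \<sigma> s\<bar> \<le> N * K"
    and V'_eq: "\<And>\<sigma>. \<sigma> \<in> signs \<Longrightarrow> (\<integral>s. V' \<sigma> s \<partial>?P) = (\<integral>s. V \<sigma> s \<partial>completion ?P)"
    by metis

  \<comment> \<open>The one-sided uniform deviation and its measurable majorant\<close>
  define E where "E f = (\<integral>z. w z * h f z \<partial>D)" for f
  define av where "av f s = (\<Sum>n<N. w (s n) * h f (s n)) / real N" for f s
  define \<Phi> where "\<Phi> s = (SUP f\<in>H. E f - av f s)" for s
  have wh_int: "integrable D (\<lambda>z. w z * h f z)" if "f \<in> H" for f
    using that whK[OF that] by (intro D.integrable_const_bound[of _ K] AE_I2) auto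
  have E_abs: "\<bar>E f\<bar> \<le> K" if "f \<in> H" for f
  proof -
    have "\<bar>E f\<bar> \<le> (\<integral>z. \<bar>w z * h f z\<bar> \<partial>D)" unfolding E_def by (rule integral_abs_bound)
    also have "\<dots> \<le> (\<integral>z. K \<partial>D)" using wh_int[OF that] whK[OF that] by (intro integral_mono) auto
    finally show ?thesis by (simp add: D.prob_space)
  qed
  have av_abs: "\<bar>av f s\<bar> \<le> K" if "f \<in> H" "s \<in> space ?P" for f s
  proof -
    have "\<bar>\<Sum>n<N. w (s n) * h f (s n)\<bar> \<le> (\<Sum>n<N. \<bar>w (s n) * h f (s n)\<bar>)" by (rule sum_abs)
    also have "\<dots> \<le> (\<Sum>n<N. K)" using whK[OF that(1) s_sp[OF that(2)]] by (intro sum_mono) auto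
    finally show ?thesis using N by (simp add: av_def field_simps)
  qed
  have dev_abs: "\<bar>E f - av f s\<bar> \<le> 2 * K" if "f \<in> H" "s \<in> space ?P" for f s
    using E_abs[OF that(1)] av_abs[OF that] by linarith
  have \<Phi>_upper: "E f - av f s \<le> \<Phi> s" if "f \<in> H" "s \<in> space ?P" for f s
    unfolding \<Phi>_def using dev_abs[OF _ that(2)] that(1)
    by (intro cSUP_upper bdd_aboveI[of _ "2 * K"]) (auto simp: abs_le_iff)
  have \<Phi>_least: "\<Phi> s \<le> x" if "\<And>f. f \<in> H \<Longrightarrow> E f - av f s \<le> x" for s x
    unfolding \<Phi>_def using that H by (intro cSUP_least) auto
  have \<Phi>_abs: "\<bar>\<Phi> s\<bar> \<le> 2 * K" if "s \<in> space ?P" for s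
  proof -
    obtain f where f: "f \<in> H" using H by blast
    have "\<Phi> s \<le> 2 * K" using dev_abs[OF _ that] by (intro \<Phi>_least) (auto simp: abs_le_iff)
    moreover have "- (2 * K) \<le> \<Phi> s" using \<Phi>_upper[OF f that] dev_abs[OF f that] by linarith
    ultimately show ?thesis by linarith
  qed
  obtain U where U[measurable]: "U \<in> borel_measurable ?P" and U_ge: "\<And>s. s \<in> space ?P \<Longrightarrow> \<Phi> s \<le> U s"
    and U_abs: "\<And>s. s \<in> space ?P \<Longrightarrow> \<bar>U s\<bar> \<le> 2 * K"
    and U_min: "\<And>V. V \<in> borel_measurable ?P \<Longrightarrow> (\<And>s. s \<in> space ?P \<Longrightarrow> \<Phi> s \<le> V s) \<Longrightarrow> AE s in ?P. U s \<le> V s"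
  proof (rule P.P.minimal_measurable_majorant[of \<Phi> "2 * K"])
    show "\<bar>\<Phi> s\<bar> \<le> 2 * K" if "s \<in> space ?P" for s using \<Phi>_abs[OF that] .
  next
    fix U assume "U \<in> borel_measurable ?P" "\<And>s. s \<in> space ?P \<Longrightarrow> \<Phi> s \<le> U s"
      "\<And>s. s \<in> space ?P \<Longrightarrow> \<bar>U s\<bar> \<le> 2 * K"
      "\<And>V. V \<in> borel_measurable ?P \<Longrightarrow> (\<And>s. s \<in> space ?P \<Longrightarrow> \<Phi> s \<le> V s) \<Longrightarrow> AE s in ?P. U s \<le> V s"
    then show thesis by (rule that)
  qed
  have U_int: "integrable ?P U" using U_abs by (intro P.P.integrable_const_bound[of _ "2 * K"] AE_I2) auto

  \<comment> \<open>Symmetrization\<close>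
  have sym: "(\<integral>s. U s \<partial>?P) \<le> ((\<integral>s. V' \<sigma> s \<partial>?P) + (\<integral>s. V' (\<lambda>n. - \<sigma> n) s \<partial>?P)) / real N"
    if \<sigma>: "\<sigma> \<in> signs" for \<sigma>
  proof -
    let ?m = "\<lambda>b (s, s'). \<lambda>n\<in>{..<N}. if b n then s' n else s n"
    define b where "b n \<longleftrightarrow> \<sigma> n = 1" for n
    have mm[measurable]: "?m b \<in> ?P \<Otimes>\<^sub>M ?P \<rightarrow>\<^sub>M ?P" for b :: "nat \<Rightarrow> bool"
      unfolding case_prod_beta' by (intro measurable_restrict) (auto intro!: measurable_If)
    \<comment> \<open>Exchanging the two samples wherever \<open>\<sigma> n = -1\<close> preserves the product measure. Doing this for each
      fixed \<open>\<sigma>\<close>, and averaging over \<open>\<sigma>\<close> only afterwards, avoids integrating a non-measurable supremum.\<close>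
    define T where "T s s' = (V' \<sigma> (?m b (s, s')) + V' (\<lambda>n. - \<sigma> n) (?m (\<lambda>n. \<not> b n) (s, s'))) / real N" for s s'
    note V'm1 = measurable_compose[OF mm V'm[OF \<sigma>]] and V'm2 = measurable_compose[OF mm V'm[OF signs_neg[OF \<sigma>]]]
    have Tm: "(\<lambda>x. T (fst x) (snd x)) \<in> borel_measurable (?P \<Otimes>\<^sub>M ?P)"
      using V'm1[of b] V'm2[of "\<lambda>n. \<not> b n"] unfolding T_def by simp
    have m_sp: "?m b (s, s') \<in> space ?P" if "s \<in> space ?P" "s' \<in> space ?P" for b s s'
      using that by (auto simp: space_PiM PiE_iff)
    have int1: "integrable (?P \<Otimes>\<^sub>M ?P) (\<lambda>x. V' \<sigma>' (?m b x))"
      and int1_eq: "(\<integral>x. V' \<sigma>' (?m b x) \<partial>(?P \<Otimes>\<^sub>M ?P)) = (\<integral>s. V' \<sigma>' s \<partial>?P)"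
      if "\<sigma>' \<in> signs" for \<sigma>' b
    proof -
      have "integrable ?P (V' \<sigma>')"
        using V'm[OF that] V'_abs[OF that] by (intro P.P.integrable_const_bound[of _ "N * K"] AE_I2) auto
      then have "integrable (distr (?P \<Otimes>\<^sub>M ?P) ?P (?m b)) (V' \<sigma>')" by (subst P.distr_PiM_mix) auto
      then show "integrable (?P \<Otimes>\<^sub>M ?P) (\<lambda>x. V' \<sigma>' (?m b x))" by (rule integrable_distr[OF mm])
      have "(\<integral>x. V' \<sigma>' (?m b x) \<partial>(?P \<Otimes>\<^sub>M ?P)) = (\<integral>s. V' \<sigma>' s \<partial>distr (?P \<Otimes>\<^sub>M ?P) ?P (?m b))"
        by (rule integral_distr[OF mm V'm[OF that], symmetric])
      also have "\<dots> = (\<integral>s. V' \<sigma>' s \<partial>?P)" by (subst P.distr_PiM_mix) auto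
      finally show "(\<integral>x. V' \<sigma>' (?m b x) \<partial>(?P \<Otimes>\<^sub>M ?P)) = (\<integral>s. V' \<sigma>' s \<partial>?P)" .
    qed
    have T_int: "integrable (?P \<Otimes>\<^sub>M ?P) (\<lambda>x. T (fst x) (snd x))"
      using int1[OF \<sigma>, of b] int1[OF signs_neg[OF \<sigma>], of "\<lambda>n. \<not> b n"] by (simp add: T_def)
    have T_abs: "\<bar>T s s'\<bar> \<le> 2 * K" if "s \<in> space ?P" "s' \<in> space ?P" for s s'
    proof -
      have "\<bar>V' \<sigma> (?m b (s, s')) + V' (\<lambda>n. - \<sigma> n) (?m (\<lambda>n. \<not> b n) (s, s'))\<bar> \<le> 2 * (N * K)"
        using V'_abs[OF \<sigma> m_sp[OF that, of b]] V'_abs[OF signs_neg[OF \<sigma>] m_sp[OF that, of "\<lambda>n. \<not> b n"]] by linarith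
      then show ?thesis using N by (simp add: T_def field_simps)
    qed
    \<comment> \<open>Where \<open>\<sigma> n = 1\<close> the first mixture supplies
      \<open>s'\<close> and the second \<open>s\<close>; elsewhere the roles are exchanged, and the
      signs produce the same difference.\<close>
    have T_dom: "av f s' - av f s \<le> T s s'" if "f \<in> H" "s \<in> space ?P" "s' \<in> space ?P" for f s s'
    proof -
      let ?g = "\<lambda>z. w z * h f z"
      have "(\<Sum>n<N. ?g (s' n)) - (\<Sum>n<N. ?g (s n)) =
          (\<Sum>n<N. \<sigma> n * ?g (?m b (s, s') n)) + (\<Sum>n<N. - \<sigma> n * ?g (?m (\<lambda>n. \<not> b n) (s, s') n))"
        unfolding sum.distrib[symmetric] sum_subtractf[symmetric]
        using signs_val[OF \<sigma>] by (intro sum.cong) (fastforce simp: b_def)+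
      also have "\<dots> \<le> V' \<sigma> (?m b (s, s')) + V' (\<lambda>n. - \<sigma> n) (?m (\<lambda>n. \<not> b n) (s, s'))"
        by (intro add_mono order_trans[OF V_upper V'_ge] \<sigma> signs_neg that(1) m_sp[OF that(2,3)])
      finally show ?thesis
        unfolding av_def T_def diff_divide_distrib[symmetric] by (intro divide_right_mono) auto
    qed
    have Ts_int: "integrable ?P (T s)" if "s \<in> space ?P" for s
      using measurable_compose[OF measurable_Pair1'[OF that] Tm] T_abs[OF that]
      by (intro P.P.integrable_const_bound[of _ "2 * K"] AE_I2) auto
    have av_int: "integrable ?P (av f)" and av_eq: "(\<integral>s. av f s \<partial>?P) = E f" if f: "f \<in> H" for f
    proof -
      have 1: "integrable ?P (\<lambda>s. w (s n) * h f (s n))" "(\<integral>s. w (s n) * h f (s n) \<partial>?P) = E f" if "n < N" for n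
      proof -
        have d: "distr ?P D (\<lambda>s. s n) = D" using P.PiM_component[of n] that by simp
        have "integrable (distr ?P D (\<lambda>s. s n)) (\<lambda>z. w z * h f z)" unfolding d by (rule wh_int[OF f])
        then show "integrable ?P (\<lambda>s. w (s n) * h f (s n))" by (rule integrable_distr[OF comp[OF that]])
        show "(\<integral>s. w (s n) * h f (s n) \<partial>?P) = E f"
          using integral_distr[OF comp[OF that], of "\<lambda>z. w z * h f z"] f unfolding d E_def by simp
      qed
      show "integrable ?P (av f)" unfolding av_def using 1 by (intro integrable_divide Bochner_Integration.integrable_sum) auto
      show "(\<integral>s. av f s \<partial>?P) = E f"
        unfolding av_def using 1 N by (simp add: Bochner_Integration.integral_sum)
    qed
    \<comment> \<open>Integrating out the ghost sample \<open>s'\<close> yields a measurable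
      majorant of \<Phi>, to which minimality of \<open>U\<close> applies.\<close>
    have "AE s in ?P. U s \<le> (\<integral>s'. T s s' \<partial>?P)"
    proof (rule U_min)
      show "(\<lambda>s. \<integral>s'. T s s' \<partial>?P) \<in> borel_measurable ?P"
        using P.P.borel_measurable_lebesgue_integral[of T ?P] Tm by (simp add: case_prod_beta')
      show "\<Phi> s \<le> (\<integral>s'. T s s' \<partial>?P)" if s: "s \<in> space ?P" for s
      proof (rule \<Phi>_least)
        fix f assume f: "f \<in> H"
        have "E f - av f s = (\<integral>s'. av f s' - av f s \<partial>?P)"
          using av_int[OF f] av_eq[OF f] by (simp add: P.P.prob_space)
        also have "\<dots> \<le> (\<integral>s'. T s s' \<partial>?P)"
          using av_int[OF f] Ts_int[OF s] T_dom[OF f s] by (intro integral_mono) auto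
        finally show "E f - av f s \<le> (\<integral>s'. T s s' \<partial>?P)" .
      qed
    qed
    then have "(\<integral>s. U s \<partial>?P) \<le> (\<integral>s. \<integral>s'. T s s' \<partial>?P \<partial>?P)"
      using U_int PP.integrable_fst'[OF T_int] by (intro integral_mono_AE) auto
    also have "\<dots> = (\<integral>x. T (fst x) (snd x) \<partial>(?P \<Otimes>\<^sub>M ?P))"
      using PP.integral_fst'[OF T_int] by simp
    also have "\<dots> = ((\<integral>s. V' \<sigma> s \<partial>?P) + (\<integral>s. V' (\<lambda>n. - \<sigma> n) s \<partial>?P)) / real N"
      using int1[OF \<sigma>, of b] int1[OF signs_neg[OF \<sigma>], of "\<lambda>n. \<not> b n"]
        int1_eq[OF \<sigma>, of b] int1_eq[OF signs_neg[OF \<sigma>], of "\<lambda>n. \<not> b n"] by (simp add: T_def)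
    finally show ?thesis .
  qed
  \<comment> \<open>Negation permutes the sign vectors, so both terms of \<open>sym\<close> have the
    same average; this is the factor 2.\<close>
  have EU: "(\<integral>s. U s \<partial>?P) \<le> 2 * R"
  proof -
    let ?I = "\<lambda>\<sigma>. \<integral>s. V \<sigma> s \<partial>completion ?P"
    have "real (card signs) * (\<integral>s. U s \<partial>?P) = (\<Sum>\<sigma>\<in>signs. \<integral>s. U s \<partial>?P)" by simp
    also have "\<dots> \<le> (\<Sum>\<sigma>\<in>signs. (?I \<sigma> + ?I (\<lambda>n. - \<sigma> n)) / real N)"
      using sym signs_neg by (intro sum_mono) (simp add: V'_eq)
    also have "\<dots> = ((\<Sum>\<sigma>\<in>signs. ?I \<sigma>) + (\<Sum>\<sigma>\<in>signs. ?I (\<lambda>n. - \<sigma> n))) / real N"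
      by (simp add: sum_divide_distrib[symmetric] sum.distrib)
    also have "(\<Sum>\<sigma>\<in>signs. ?I (\<lambda>n. - \<sigma> n)) = (\<Sum>\<sigma>\<in>signs. ?I \<sigma>)"
      by (rule sum.reindex_bij_witness[where i="\<lambda>\<sigma> n. - \<sigma> n" and j="\<lambda>\<sigma> n. - \<sigma> n"])
        (auto simp: signs_neg)
    finally show ?thesis using V_sum_int card_signs N by (simp add: field_simps)
  qed

  \<comment> \<open>Bounded differences and concentration\<close>
  have diff: "AE s in ?P. U s \<le> U (s(n := z)) + (hi - lo) / real N" if n: "n < N" and z: "z \<in> space D" for n z
  \<comment> \<open>The right-hand side is itself a measurable majorant of \<Phi>, so minimality of
    \<open>U\<close> gives the difference bound, though only almost everywhere.\<close>
  proof (rule U_min)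
    have upd: "(\<lambda>s. s(n := z)) \<in> ?P \<rightarrow>\<^sub>M ?P"
      using n z by (intro measurable_PiM_single') (auto simp: space_PiM PiE_iff extensional_def)
    show "(\<lambda>s. U (s(n := z)) + (hi - lo) / real N) \<in> borel_measurable ?P"
      using measurable_compose[OF upd U] by simp
    fix s assume s: "s \<in> space ?P"
    have s': "s(n := z) \<in> space ?P" by (rule measurable_space[OF upd s])
    show "\<Phi> s \<le> U (s(n := z)) + (hi - lo) / real N"
    proof (rule \<Phi>_least)
      fix f assume f: "f \<in> H"
      let ?g = "\<lambda>z. w z * h f z"
      have "(\<Sum>k<N. ?g ((s(n := z)) k)) - (\<Sum>k<N. ?g (s k)) = (\<Sum>k<N. if k = n then ?g z - ?g (s n) else 0)"
        unfolding sum_subtractf[symmetric] by (intro sum.cong) auto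
      also have "\<dots> = ?g z - ?g (s n)" using n by simp
      also have "\<dots> \<le> hi - lo" using wh_osc[OF f z s_sp[OF s n]] .
      finally have "av f (s(n := z)) - av f s \<le> (hi - lo) / real N"
        unfolding av_def diff_divide_distrib[symmetric] using N by (intro divide_right_mono) auto
      then show "E f - av f s \<le> U (s(n := z)) + (hi - lo) / real N"
        using \<Phi>_upper[OF f s'] U_ge[OF s'] by linarith
    qed
  qed
  have eq: "real N * ((hi - lo) / real N)\<^sup>2 = (hi - lo)\<^sup>2 / real N"
    using N by (simp add: power2_eq_square)
  have "1 - exp (- 2 * t\<^sup>2 / (real N * ((hi - lo) / real N)\<^sup>2)) \<le> measure ?P {s \<in> space ?P. U s \<le> 2 * R + t}"
    using N lo by (intro bounded_differences_tail[OF D N _ t U U_abs diff EU]) auto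
  then have "1 - exp (- 2 * real N * t\<^sup>2 / (hi - lo)\<^sup>2) \<le> measure ?P {s \<in> space ?P. U s \<le> 2 * R + t}"
    unfolding eq by (simp add: field_simps)
  moreover have "E f - av f s \<le> 2 * R + t" if "s \<in> space ?P" "U s \<le> 2 * R + t" "f \<in> H" for s f
    using \<Phi>_upper[OF that(3,1)] U_ge[OF that(1)] that(2) by linarith
  ultimately show ?thesis
    unfolding E_def av_def by (intro bexI[of _ "{s \<in> space ?P. U s \<le> 2 * R + t}"]) auto
qed

section \<open>Generalization of the restricted dual value\<close>

text \<open>An abstract probability measure covers the population problem and, with the uniform
  measure on the sample indices, the empirical one. Near-maximizers provide the approximation
  premise of \<open>multiplier_attained\<close>.\<close>

lemma (in prob_space) restricted_dual_attained:
  fixes v :: "'i \<Rightarrow> 'a \<Rightarrow> real" and a :: "'i \<Rightarrow> real"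
  assumes v: "\<And>i. i \<in> I \<Longrightarrow> v i \<in> borel_measurable M"
      "\<And>i z. i \<in> I \<Longrightarrow> z \<in> space M \<Longrightarrow> \<bar>v i z\<bar> \<le> K"
    and a: "\<And>i. i \<in> I \<Longrightarrow> A \<le> a i" and I: "I \<noteq> {}" and \<gamma>: "0 \<le> \<gamma>"
  shows "\<exists>\<mu>\<in>borel_measurable M. (\<forall>z\<in>space M. \<mu> z \<in> {0..\<gamma>}) \<and>
      (\<forall>\<nu>\<in>borel_measurable M. (\<forall>z\<in>space M. \<nu> z \<in> {0..\<gamma>}) \<longrightarrow>
        (INF i\<in>I. a i + (\<integral>z. \<nu> z * v i z \<partial>M)) \<le> (INF i\<in>I. a i + (\<integral>z. \<mu> z * v i z \<partial>M)))"
proof -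
  define \<Lambda> where "\<Lambda> = {\<nu> \<in> borel_measurable M. \<forall>z\<in>space M. \<nu> z \<in> {0..\<gamma>}}"
  define L where "L \<nu> i = a i + (\<integral>z. \<nu> z * v i z \<partial>M)" for \<nu> i
  define g where "g \<nu> = (INF i\<in>I. L \<nu> i)" for \<nu>
  have abs: "\<bar>\<integral>z. \<nu> z * v i z \<partial>M\<bar> \<le> \<gamma> * K" if "\<nu> \<in> \<Lambda>" "i \<in> I" for \<nu> i
  proof -
    have b: "\<bar>\<nu> z * v i z\<bar> \<le> \<gamma> * K" if "z \<in> space M" for z
      using \<open>\<nu> \<in> \<Lambda>\<close> v(2)[OF \<open>i \<in> I\<close> that] that \<gamma> by (auto simp: \<Lambda>_def abs_mult intro!: mult_mono)
    have "integrable M (\<lambda>z. \<nu> z * v i z)"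
      using that v(1) b by (intro integrable_const_bound[of _ "\<gamma> * K"] AE_I2) (auto simp: \<Lambda>_def)
    have "\<bar>\<integral>z. \<nu> z * v i z \<partial>M\<bar> \<le> (\<integral>z. \<bar>\<nu> z * v i z\<bar> \<partial>M)" by (rule integral_abs_bound)
    also have "\<dots> \<le> (\<integral>z. \<gamma> * K \<partial>M)"
      using \<open>integrable M (\<lambda>z. \<nu> z * v i z)\<close> b by (intro integral_mono) auto
    finally show ?thesis by (simp add: prob_space)
  qed
  have bdd: "bdd_below (L \<nu> ` I)" if "\<nu> \<in> \<Lambda>" for \<nu>
    using a abs[OF that] by (intro bdd_belowI[of _ "A - \<gamma> * K"]) (force simp: L_def abs_le_iff)
  obtain i0 where i0: "i0 \<in> I" using I by blast
  have "g \<nu> \<le> a i0 + \<gamma> * K" if "\<nu> \<in> \<Lambda>" for \<nu>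
    using cINF_lower[OF bdd[OF that] i0] abs[OF that i0] by (simp add: g_def L_def abs_le_iff)
  then have gbdd: "bdd_above (g ` \<Lambda>)" by (intro bdd_aboveI[of _ "a i0 + \<gamma> * K"]) auto
  have "(\<lambda>_. 0) \<in> \<Lambda>" using \<gamma> by (simp add: \<Lambda>_def)
  then have ne: "\<Lambda> \<noteq> {}" by blast
  define d where "d = (SUP \<nu>\<in>\<Lambda>. g \<nu>)"
  have "\<exists>\<mu>\<in>borel_measurable M. (\<forall>z\<in>space M. \<mu> z \<in> {0..\<gamma>}) \<and>
        (\<forall>i\<in>I. d \<le> a i + (\<integral>z. \<mu> z * v i z \<partial>M))"
  proof (rule multiplier_attained[OF v])
    fix e :: real assume "e > 0"
    then obtain \<nu> where \<nu>: "\<nu> \<in> \<Lambda>" "d - e < g \<nu>"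
      using less_cSUP_iff[OF ne gbdd, of "d - e"] by (auto simp: d_def)
    have "d - e \<le> L \<nu> i" if "i \<in> I" for i
      using \<nu>(2) cINF_lower[OF bdd[OF \<nu>(1)] that] by (simp add: g_def)
    then show "\<exists>\<mu>\<in>borel_measurable M. (\<forall>z\<in>space M. \<mu> z \<in> {0..\<gamma>}) \<and>
        (\<forall>i\<in>I. d - e \<le> a i + (\<integral>z. \<mu> z * v i z \<partial>M))"
      using \<nu>(1) by (intro bexI[of _ \<nu>]) (auto simp: \<Lambda>_def L_def)
  qed auto
  then obtain \<mu> where \<mu>: "\<mu> \<in> \<Lambda>" "\<And>i. i \<in> I \<Longrightarrow> d \<le> L \<mu> i" by (auto simp: \<Lambda>_def L_def)
  have "g \<nu> \<le> g \<mu>" if "\<nu> \<in> \<Lambda>" for \<nu>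
  proof -
    have "g \<nu> \<le> d" unfolding d_def using gbdd that by (intro cSUP_upper)
    also have "d \<le> g \<mu>" unfolding g_def using I \<mu>(2) by (intro cINF_greatest) auto
    finally show ?thesis .
  qed
  then show ?thesis using \<mu>(1) by (intro bexI[of _ \<mu>]) (auto simp: \<Lambda>_def g_def L_def)
qed

lemma L1_plus_bounded_iff:
  "\<mu> \<in> L1_plus_bounded D \<gamma> \<longleftrightarrow>
    integrable D \<mu> \<and> (\<forall>z\<in>space D. 0 \<le> \<mu> z) \<and> (AE z in D. \<mu> z \<le> \<gamma>)"
proof -
  have "(esssup D (\<lambda>z. ereal \<bar>\<mu> z\<bar>) \<le> ereal \<gamma>) \<longleftrightarrow> (AE z in D. \<mu> z \<le> \<gamma>)"
    if i: "integrable D \<mu>" and nn: "\<forall>z\<in>space D. 0 \<le> \<mu> z"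
  proof
    assume le: "esssup D (\<lambda>z. ereal \<bar>\<mu> z\<bar>) \<le> ereal \<gamma>"
    from esssup_AE[of "\<lambda>z. ereal \<bar>\<mu> z\<bar>" D] show "AE z in D. \<mu> z \<le> \<gamma>"
    proof eventually_elim
      case (elim z)
      from order_trans[OF elim le] show ?case by simp
    qed
  next
    assume le: "AE z in D. \<mu> z \<le> \<gamma>"
    have "AE z in D. ereal \<bar>\<mu> z\<bar> \<le> ereal \<gamma>"
      using le AE_space by eventually_elim (use nn in auto)
    moreover have "\<mu> \<in> borel_measurable D" using i by auto
    ultimately show "esssup D (\<lambda>z. ereal \<bar>\<mu> z\<bar>) \<le> ereal \<gamma>"
      by (intro esssup_I) auto
  qed
  then show ?thesis by (auto simp: L1_plus_bounded_def L1_plus_def)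
qed

text \<open>Carries an event of the product measure, where the deviation bounds are proved, to the
  space \<open>M\<close> on which the samples live.\<close>

lemma iid_sample_event:
  assumes M: "prob_space M" and N: "1 \<le> N" and S: "iid_sample M Q N S"
    and A: "A \<in> sets (Pi\<^sub>M {..<N} (\<lambda>_. Q))"
  defines "A' \<equiv> {\<omega> \<in> space M. (\<lambda>n\<in>{..<N}. S n \<omega>) \<in> A}"
  shows "A' \<in> sets M" "measure M A' = measure (Pi\<^sub>M {..<N} (\<lambda>_. Q)) A"
proof -
  interpret prob_space M by (rule M)
  have ind: "indep_vars (\<lambda>_. Q) S {..<N}" and d: "\<And>n. n < N \<Longrightarrow> distr M Q (S n) = Q"
    using S by (auto simp: iid_sample_def)
  have S_meas: "S n \<in> M \<rightarrow>\<^sub>M Q" if "n < N" for n using ind that by (auto simp: indep_vars_def)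
  then have m: "(\<lambda>\<omega>. \<lambda>n\<in>{..<N}. S n \<omega>) \<in> M \<rightarrow>\<^sub>M Pi\<^sub>M {..<N} (\<lambda>_. Q)"
    by (intro measurable_restrict) auto
  have "{..<N} \<noteq> {}" using N by (simp add: lessThan_empty_iff)
  then have "distr M (Pi\<^sub>M {..<N} (\<lambda>_. Q)) (\<lambda>\<omega>. \<lambda>n\<in>{..<N}. S n \<omega>) = Pi\<^sub>M {..<N} (\<lambda>n. distr M Q (S n))"
    using indep_vars_iff_distr_eq_PiM'[where I="{..<N}" and M'="\<lambda>_. Q" and X=S] ind S_meas by auto
  also have "\<dots> = Pi\<^sub>M {..<N} (\<lambda>_. Q)" using d by (intro PiM_cong) auto
  finally have eq: "distr M (Pi\<^sub>M {..<N} (\<lambda>_. Q)) (\<lambda>\<omega>. \<lambda>n\<in>{..<N}. S n \<omega>) = Pi\<^sub>M {..<N} (\<lambda>_. Q)" .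
  have A': "A' = (\<lambda>\<omega>. \<lambda>n\<in>{..<N}. S n \<omega>) -` A \<inter> space M" by (auto simp: A'_def)
  show "A' \<in> sets M" unfolding A' using m A by (rule measurable_sets)
  show "measure M A' = measure (Pi\<^sub>M {..<N} (\<lambda>_. Q)) A"
    unfolding A' using measure_distr[OF m A] by (simp add: eq)
qed

lemma iid_sample_in_space:
  assumes M: "prob_space M" and S: "iid_sample M Q N S" and "n < N" "\<omega> \<in> space M"
  shows "S n \<omega> \<in> space Q"
proof -
  interpret prob_space M by (rule M)
  have "S n \<in> M \<rightarrow>\<^sub>M Q" using S \<open>n < N\<close> by (auto simp: iid_sample_def indep_vars_def)
  then show ?thesis using \<open>\<omega> \<in> space M\<close> by (rule measurable_space)
qed

lemma rademacher_complexity_eq_signs: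
  "rademacher_complexity Q H h N =
    (\<integral>s. (\<Sum>\<sigma>\<in>PiE_dflt {..<N} 0 (\<lambda>_. {-1, 1}). rademacher_sup H h N \<sigma> s) /
        real (card (PiE_dflt {..<N} (0 :: real) (\<lambda>_. {-1, 1}))) \<partial>sample_measure Q N) / real N"
proof -
  let ?S = "PiE_dflt {..<N} (0 :: real) (\<lambda>_. {-1, 1})"
  have "(\<lambda>n. if n < N then 1 else 0) \<in> ?S" by (auto simp: PiE_dflt_def)
  then have "?S \<noteq> {}" by blast
  moreover have "finite ?S" by (intro finite_PiE_dflt) auto
  moreover have "Pi_pmf {..<N} 0 (\<lambda>_. pmf_of_set {-1, 1}) = pmf_of_set ?S"
    by (rule Pi_pmf_of_set) auto
  ultimately show ?thesis unfolding rademacher_complexity_def by (simp add: integral_pmf_of_set)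
qed

text \<open>The supremum dominates the value at a fixed predictor, which averages to 0 because
  negation permutes the sign vectors. The purpose is to make the rates at least as large as their
  confidence term.\<close>

lemma rademacher_complexity_nonneg:
  assumes H: "H \<noteq> {}" and K: "\<And>f z. f \<in> H \<Longrightarrow> z \<in> space Q \<Longrightarrow> \<bar>loss_at h f z\<bar> \<le> K"
  shows "0 \<le> rademacher_complexity Q H h N"
proof -
  let ?S = "PiE_dflt {..<N} (0 :: real) (\<lambda>_. {-1, 1})"
  obtain f where f: "f \<in> H" using H by blast
  have "0 \<le> (\<Sum>\<sigma>\<in>?S. rademacher_sup H h N \<sigma> s)" if s: "s \<in> space (sample_measure Q N)" for s
  proof -
    have s_sp: "s n \<in> space Q" if "n < N" for n
      using s that by (auto simp: sample_measure_def space_PiM PiE_iff)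
    have "(\<Sum>n<N. \<sigma> n * loss_at h f (s n)) \<le> rademacher_sup H h N \<sigma> s" for \<sigma>
      unfolding rademacher_sup_def
    proof (rule cSUP_upper[OF f], rule bdd_aboveI2)
      fix f' assume f': "f' \<in> H"
      have "\<sigma> n * loss_at h f' (s n) \<le> \<bar>\<sigma> n\<bar> * K" if "n < N" for n
        using mult_left_mono[OF K[OF f' s_sp[OF that]], of "\<bar>\<sigma> n\<bar>"] abs_ge_self[of "\<sigma> n * loss_at h f' (s n)"]
        by (simp add: abs_mult)
      then show "(\<Sum>n<N. \<sigma> n * loss_at h f' (s n)) \<le> (\<Sum>n<N. \<bar>\<sigma> n\<bar> * K)" by (intro sum_mono) auto
    qed
    then have "(\<Sum>\<sigma>\<in>?S. \<Sum>n<N. \<sigma> n * loss_at h f (s n)) \<le> (\<Sum>\<sigma>\<in>?S. rademacher_sup H h N \<sigma> s)"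
      by (intro sum_mono)
    moreover have "(\<Sum>\<sigma>\<in>?S. \<Sum>n<N. \<sigma> n * loss_at h f (s n)) = (\<Sum>\<sigma>\<in>?S. - (\<Sum>n<N. \<sigma> n * loss_at h f (s n)))"
      by (rule sum.reindex_bij_witness[where i="\<lambda>\<sigma> n. - \<sigma> n" and j="\<lambda>\<sigma> n. - \<sigma> n"])
        (auto simp: PiE_dflt_def sum_negf)
    then have "(\<Sum>\<sigma>\<in>?S. \<Sum>n<N. \<sigma> n * loss_at h f (s n)) = 0" by (simp add: sum_negf)
    ultimately show ?thesis by simp
  qed
  then show ?thesis
    unfolding rademacher_complexity_eq_signs by (intro divide_nonneg_nonneg Bochner_Integration.integral_nonneg) auto
qed

text \<open>Brings the complexity into the form of the constant \<open>R\<close> of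
  \<open>weighted_uniform_deviation\<close>; well-definedness justifies exchanging integral and
  sum.\<close>

lemma rademacher_complexity_eq_sum:
  assumes "rademacher_well_defined Q H h" "1 \<le> N"
  defines "\<Sigma> \<equiv> PiE_dflt {..<N} (0 :: real) (\<lambda>_. {-1, 1})"
  shows "\<And>\<sigma>. \<sigma> \<in> \<Sigma> \<Longrightarrow> integrable (completion (Pi\<^sub>M {..<N} (\<lambda>_. Q))) (\<lambda>s. SUP f\<in>H. \<Sum>n<N. \<sigma> n * loss_at h f (s n))"
    "rademacher_complexity Q H h N =
      (\<Sum>\<sigma>\<in>\<Sigma>. \<integral>s. (SUP f\<in>H. \<Sum>n<N. \<sigma> n * loss_at h f (s n)) \<partial>completion (Pi\<^sub>M {..<N} (\<lambda>_. Q)))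
        / real (card \<Sigma>) / real N"
proof -
  have "\<sigma> \<in> {..<N} \<rightarrow> {-1, 1}" if "\<sigma> \<in> \<Sigma>" for \<sigma> using that by (auto simp: \<Sigma>_def PiE_dflt_def)
  then have i: "integrable (sample_measure Q N) (rademacher_sup H h N \<sigma>)" if "\<sigma> \<in> \<Sigma>" for \<sigma>
    using assms(1,2) that by (auto simp: rademacher_well_defined_def)
  show "integrable (completion (Pi\<^sub>M {..<N} (\<lambda>_. Q))) (\<lambda>s. SUP f\<in>H. \<Sum>n<N. \<sigma> n * loss_at h f (s n))" if "\<sigma> \<in> \<Sigma>" for \<sigma>
    using i[OF that] by (simp add: sample_measure_def rademacher_sup_def[abs_def])
  show "rademacher_complexity Q H h N =
      (\<Sum>\<sigma>\<in>\<Sigma>. \<integral>s. (SUP f\<in>H. \<Sum>n<N. \<sigma> n * loss_at h f (s n)) \<partial>completion (Pi\<^sub>M {..<N} (\<lambda>_. Q)))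
        / real (card \<Sigma>) / real N"
    unfolding rademacher_complexity_eq_signs \<Sigma>_def[symmetric] integral_divide_zero
      sample_measure_def[symmetric] rademacher_sup_def[symmetric]
    using i by (simp add: Bochner_Integration.integral_sum)
qed

text \<open>The two sides of the saddle value: as \<open>f\<close> minimizes at \<mu>, any predictor
  bounds it from above; as \<mu> maximizes the dual function, any multiplier bounds it from below.
  This holds for every choice of optimizers, so no measurable selection is involved.\<close>

lemma empirical_value_bounds:
  assumes \<mu>: "is_arg_max (emp_dual_fun N s0 s H l0 l) (\<lambda>\<mu>. \<mu> \<in> \<Lambda>) \<mu>"
    and f: "is_arg_min (\<lambda>f. emp_lagrangian N s0 s l0 l f \<mu>) (\<lambda>f. f \<in> H) f"
  shows "\<mu> \<in> \<Lambda>" "\<And>f'. f' \<in> H \<Longrightarrow> emp_lagrangian N s0 s l0 l f \<mu> \<le> emp_lagrangian N s0 s l0 l f' \<mu>"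
    "\<And>\<nu> x. \<nu> \<in> \<Lambda> \<Longrightarrow> (\<And>f'. f' \<in> H \<Longrightarrow> x \<le> emp_lagrangian N s0 s l0 l f' \<nu>) \<Longrightarrow>
       x \<le> emp_lagrangian N s0 s l0 l f \<mu>"
proof -
  show "\<mu> \<in> \<Lambda>" using \<mu> by (simp add: is_arg_max_def)
  show min: "emp_lagrangian N s0 s l0 l f \<mu> \<le> emp_lagrangian N s0 s l0 l f' \<mu>" if "f' \<in> H" for f'
    using f that by (auto simp: is_arg_min_def not_less)
  have fH: "f \<in> H" using f by (simp add: is_arg_min_def)
  fix \<nu> x assume \<nu>: "\<nu> \<in> \<Lambda>" and x: "\<And>f'. f' \<in> H \<Longrightarrow> x \<le> emp_lagrangian N s0 s l0 l f' \<nu>"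
  have "x \<le> emp_dual_fun N s0 s H l0 l \<nu>"
    unfolding emp_dual_fun_def using fH x by (intro cINF_greatest) auto
  also have "\<dots> \<le> emp_dual_fun N s0 s H l0 l \<mu>" using \<mu> \<nu> by (auto simp: is_arg_max_def not_less)
  also have "\<dots> \<le> emp_lagrangian N s0 s l0 l f \<mu>"
    unfolding emp_dual_fun_def using fH min by (intro cINF_lower bdd_belowI2[where m="emp_lagrangian N s0 s l0 l f \<mu>"]) auto
  finally show "x \<le> emp_lagrangian N s0 s l0 l f \<mu>" .
qed

lemma (in prob_space) prob_Int_ge:
  assumes "A \<in> sets M" "B \<in> sets M" "1 - a \<le> prob A" "1 - b \<le> prob B"
  shows "1 - (a + b) \<le> prob (A \<inter> B)"
proof -
  have "prob (A \<union> B) + prob (A \<inter> B) = prob A + prob B"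
    using measure_Un3[of A M B] assms(1,2) by (auto simp: fmeasurable_eq_sets)
  with assms prob_le_1[of "A \<union> B"] show ?thesis by linarith
qed

theorem theorem2:
  fixes MX :: "'x measure" and MY :: "'y measure"
    and D0 D :: "('x \<times> 'y) measure"
    and \<Theta> :: "(real ^ 'p) set" and predictor :: "real ^ 'p \<Rightarrow> 'x \<Rightarrow> 'y"
    and H :: "('x \<Rightarrow> 'y) set"
    and l0 l1 l :: "'y \<Rightarrow> 'y \<Rightarrow> real" and B c \<gamma> :: real
    and \<zeta>0 \<zeta> \<zeta>I :: "('x \<times> 'y) measure \<Rightarrow> nat \<Rightarrow> real \<Rightarrow> real"
    and M :: "'w measure" and N :: nat
    and S0 S :: "nat \<Rightarrow> 'w \<Rightarrow> 'x \<times> 'y"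
  assumes distributions: "D0 \<in> distributions (MX \<Otimes>\<^sub>M MY)" "D \<in> distributions (MX \<Otimes>\<^sub>M MY)"
    and predictors: "H = predictor ` \<Theta>" "\<forall>f\<in>H. f \<in> space MX \<rightarrow> space MY"
    and l0_range: "\<forall>a\<in>space MY. \<forall>b\<in>space MY. l0 a b \<in> {0..B}"
    and l1_range: "\<forall>a\<in>space MY. \<forall>b\<in>space MY. l1 a b \<in> {0..B}"
    and l_eq: "l = constraint_loss l1 c"
    and loss_measurable:
      "\<forall>f\<in>H. loss_at l0 f \<in> borel_measurable (MX \<Otimes>\<^sub>M MY)"
      "\<forall>f\<in>H. loss_at l1 f \<in> borel_measurable (MX \<Otimes>\<^sub>M MY)"
    and gamma: "0 \<le> \<gamma>"
    and samples: "prob_space M" "1 \<le> N" "iid_sample M D0 N S0" "iid_sample M D N S"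
    and minima_attained:
      "\<forall>\<mu>\<in>L1_plus D. \<exists>f. is_arg_min (\<lambda>f. lagrangian D0 D l0 l f \<mu>) (\<lambda>f. f \<in> H) f"
      "AE \<omega> in M. \<forall>\<mu>\<in>{..<N} \<rightarrow>\<^sub>E {0..}. \<exists>f.
         is_arg_min (\<lambda>f. emp_lagrangian N (\<lambda>n. S0 n \<omega>) (\<lambda>n. S n \<omega>) l0 l f \<mu>) (\<lambda>f. f \<in> H) f"
    and uniform_conv:
      "uniform_convergence (MX \<Otimes>\<^sub>M MY) H l0 \<zeta>0"
      "uniform_convergence (MX \<Otimes>\<^sub>M MY) H l \<zeta>"
      "uniform_convergence (MX \<Otimes>\<^sub>M MY) H (indicator_loss l) \<zeta>I"
    and rademacher_meaningful:
      "rademacher_well_defined D0 H l0"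
      "rademacher_well_defined D H l"
      "rademacher_well_defined D H (indicator_loss l)"
    and rademacher_rates:
      "vanishing_rademacher_rate D0 H l0 B (\<zeta>0 D0)"
      "vanishing_rademacher_rate D H l B (\<zeta> D)"
      "vanishing_rademacher_rate D H (indicator_loss l) 1 (\<zeta>I D)"
    and dual_attainment:
      "\<exists>\<mu>. is_arg_max (dual_fun D0 D H l0 l) (\<lambda>\<mu>. \<mu> \<in> L1_plus D) \<mu>"
      "AE \<omega> in M. \<exists>\<mu>. is_arg_max (emp_dual_fun N (\<lambda>n. S0 n \<omega>) (\<lambda>n. S n \<omega>) H l0 l)
         (\<lambda>\<mu>. \<mu> \<in> {..<N} \<rightarrow>\<^sub>E {0..}) \<mu>"
  shows
    "(\<exists>\<mu>. is_arg_max (dual_fun D0 D H l0 l) (\<lambda>\<mu>. \<mu> \<in> L1_plus_bounded D \<gamma>) \<mu>) \<and>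
     (\<forall>\<omega>\<in>space M. \<exists>\<mu>. is_arg_max (emp_dual_fun N (\<lambda>n. S0 n \<omega>) (\<lambda>n. S n \<omega>) H l0 l)
        (\<lambda>\<mu>. \<mu> \<in> {..<N} \<rightarrow>\<^sub>E {0..\<gamma>}) \<mu>) \<and>
     (\<forall>\<delta>\<in>{0<..<1}. holds_with_prob M (1 - 4 * \<delta>) (\<lambda>\<omega>. \<forall>\<mu> f.
        is_arg_max (emp_dual_fun N (\<lambda>n. S0 n \<omega>) (\<lambda>n. S n \<omega>) H l0 l)
          (\<lambda>\<mu>. \<mu> \<in> {..<N} \<rightarrow>\<^sub>E {0..\<gamma>}) \<mu> \<longrightarrow>
        is_arg_min (\<lambda>f. emp_lagrangian N (\<lambda>n. S0 n \<omega>) (\<lambda>n. S n \<omega>) l0 l f \<mu>) (\<lambda>f. f \<in> H) f \<longrightarrow>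
        \<bar>(SUP \<mu>\<in>L1_plus_bounded D \<gamma>. dual_fun D0 D H l0 l \<mu>)
           - emp_lagrangian N (\<lambda>n. S0 n \<omega>) (\<lambda>n. S n \<omega>) l0 l f \<mu>\<bar>
          \<le> 2 * \<zeta>0 D0 N \<delta> + \<gamma> * \<zeta> D N \<delta>))"
proof -

  \<comment> \<open>Setting and ranges of the losses\<close>
  interpret M: prob_space M by (rule samples(1))
  interpret D: prob_space D using distributions by (simp add: distributions_def)
  interpret D0: prob_space D0 using distributions by (simp add: distributions_def)
  have setsD[measurable_cong]: "sets D = sets (MX \<Otimes>\<^sub>M MY)" "sets D0 = sets (MX \<Otimes>\<^sub>M MY)"
    using distributions by (simp_all add: distributions_def)
  have spD: "space D = space MX \<times> space MY" "space D0 = space MX \<times> space MY"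
    using sets_eq_imp_space_eq[OF setsD(1)] sets_eq_imp_space_eq[OF setsD(2)] by (auto simp: space_pair_measure)
  have N: "0 < N" using samples(2) by simp
  have fY: "f x \<in> space MY" if "f \<in> H" "x \<in> space MX" for f x using predictors(2) that by (auto simp: Pi_iff)
  have l0_bd: "loss_at l0 f z \<in> {0..B}" if "f \<in> H" "z \<in> space MX \<times> space MY" for f z
    using that l0_range fY[OF that(1)] by (auto simp: loss_at_def)
  have l_bd: "loss_at l f z \<in> {- c..B - c}" if "f \<in> H" "z \<in> space MX \<times> space MY" for f z
    using that l1_range fY[OF that(1)] by (auto simp: loss_at_def l_eq constraint_loss_def)
  define K where "K = max \<bar>- c\<bar> \<bar>B - c\<bar>"
  have l_abs: "\<bar>loss_at l f z\<bar> \<le> K" if "f \<in> H" "z \<in> space MX \<times> space MY" for f z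
    using l_bd[OF that] by (auto simp: K_def)
  have l_meas: "loss_at l f \<in> borel_measurable D" if "f \<in> H" for f
  proof -
    have "loss_at l1 f \<in> borel_measurable D"
      using loss_measurable(2) that setsD(1) measurable_cong_sets by blast
    moreover have "loss_at l f = (\<lambda>z. loss_at l1 f z - c)"
      by (auto simp: loss_at_def l_eq constraint_loss_def)
    ultimately show ?thesis by simp
  qed
  \<comment> \<open>The attained minimum at the zero multiplier exhibits an element of
    \<open>H\<close>.\<close>
  have "(\<lambda>_. 0) \<in> L1_plus D" by (simp add: L1_plus_def)
  from bspec[OF minima_attained(1) this] have H: "H \<noteq> {}" by (auto simp: is_arg_min_def)
  obtain f0 where f0: "f0 \<in> H" using H by blast
  define a where "a f = (\<integral>z. loss_at l0 f z \<partial>D0)" for f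
  have a0: "0 \<le> a f" if "f \<in> H" for f
    unfolding a_def using l0_bd[OF that] spD by (intro Bochner_Integration.integral_nonneg) auto
  have dual_eq: "dual_fun D0 D H l0 l \<nu> = (INF f\<in>H. a f + (\<integral>z. \<nu> z * loss_at l f z \<partial>D))" for \<nu>
    by (simp add: dual_fun_def lagrangian_def a_def)
  have S0_sp: "S0 n \<omega> \<in> space MX \<times> space MY" if "n < N" "\<omega> \<in> space M" for n \<omega>
    using iid_sample_in_space[OF samples(1,3) that] spD by simp
  have S_sp: "S n \<omega> \<in> space MX \<times> space MY" if "n < N" "\<omega> \<in> space M" for n \<omega>
    using iid_sample_in_space[OF samples(1,4) that] spD by simp

  \<comment> \<open>Attainment of the population problem\<close>
  obtain \<rho> where \<rho>m[measurable]: "\<rho> \<in> borel_measurable D" and \<rho>_range: "\<And>z. z \<in> space D \<Longrightarrow> \<rho> z \<in> {0..\<gamma>}"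
    and \<rho>_max: "\<And>\<nu>. \<nu> \<in> borel_measurable D \<Longrightarrow> (\<And>z. z \<in> space D \<Longrightarrow> \<nu> z \<in> {0..\<gamma>}) \<Longrightarrow>
        dual_fun D0 D H l0 l \<nu> \<le> dual_fun D0 D H l0 l \<rho>"
  proof -
    have "\<exists>\<mu>\<in>borel_measurable D. (\<forall>z\<in>space D. \<mu> z \<in> {0..\<gamma>}) \<and>
      (\<forall>\<nu>\<in>borel_measurable D. (\<forall>z\<in>space D. \<nu> z \<in> {0..\<gamma>}) \<longrightarrow>
        dual_fun D0 D H l0 l \<nu> \<le> dual_fun D0 D H l0 l \<mu>)"
      unfolding dual_eq
    proof (rule D.restricted_dual_attained[OF l_meas _ a0 H gamma])
      show "\<bar>loss_at l f z\<bar> \<le> K" if "f \<in> H" "z \<in> space D" for f z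
        using l_abs that by (simp add: spD)
    qed
    then show thesis using that by blast
  qed
  have \<nu>l_int: "integrable D (\<lambda>z. \<nu> z * loss_at l f z)"
    if "\<nu> \<in> borel_measurable D" "\<And>z. z \<in> space D \<Longrightarrow> \<nu> z \<in> {0..\<gamma>}" "f \<in> H" for \<nu> f
  proof (rule D.integrable_const_bound[where B="\<gamma> * K"])
    show "(\<lambda>z. \<nu> z * loss_at l f z) \<in> borel_measurable D"
      by (intro borel_measurable_times that(1) l_meas[OF that(3)])
    show "AE z in D. norm (\<nu> z * loss_at l f z) \<le> \<gamma> * K"
    proof (rule AE_I2)
      fix z assume z: "z \<in> space D"
      show "norm (\<nu> z * loss_at l f z) \<le> \<gamma> * K"
        using that(2)[OF z] l_abs[OF that(3), of z] z gamma spD by (simp add: abs_mult mult_mono)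
    qed
  qed
  have L_bdd: "bdd_below ((\<lambda>f. a f + (\<integral>z. \<nu> z * loss_at l f z \<partial>D)) ` H)"
    if "\<nu> \<in> borel_measurable D" "\<And>z. z \<in> space D \<Longrightarrow> \<nu> z \<in> {0..\<gamma>}" for \<nu>
  proof (rule bdd_belowI2[where m="- (\<gamma> * K)"])
    fix f assume f: "f \<in> H"
    have "(\<integral>z. - (\<gamma> * K) \<partial>D) \<le> (\<integral>z. \<nu> z * loss_at l f z \<partial>D)"
    proof (rule integral_mono[OF _ \<nu>l_int[OF that f]])
      fix z assume z: "z \<in> space D"
      have "\<bar>\<nu> z * loss_at l f z\<bar> \<le> \<gamma> * K"
        using that(2)[OF z] l_abs[OF f, of z] z gamma spD by (simp add: abs_mult mult_mono)
      then show "- (\<gamma> * K) \<le> \<nu> z * loss_at l f z" by linarith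
    qed auto
    then show "- (\<gamma> * K) \<le> a f + (\<integral>z. \<nu> z * loss_at l f z \<partial>D)"
      using a0[OF f] by (simp add: D.prob_space)
  qed
  have \<rho>_in: "\<rho> \<in> L1_plus_bounded D \<gamma>"
  proof -
    have "integrable D \<rho>"
      using \<rho>_range \<rho>m by (intro D.integrable_const_bound[of _ \<gamma>] AE_I2) auto
    then show ?thesis unfolding L1_plus_bounded_iff using \<rho>_range by auto
  qed
  \<comment> \<open>An element of \<open>L1_plus_bounded\<close> exceeds \<gamma> only on a null
    set; truncation there changes no integral and gives the pointwise range that maximality of
    \<rho> demands.\<close>
  have \<rho>_max': "dual_fun D0 D H l0 l \<mu> \<le> dual_fun D0 D H l0 l \<rho>" if "\<mu> \<in> L1_plus_bounded D \<gamma>" for \<mu>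
  proof -
    have \<mu>: "integrable D \<mu>" "\<And>z. z \<in> space D \<Longrightarrow> 0 \<le> \<mu> z" "AE z in D. \<mu> z \<le> \<gamma>"
      using that by (auto simp: L1_plus_bounded_iff)
    have \<mu>m: "\<mu> \<in> borel_measurable D" using \<mu>(1) by auto
    have "(\<integral>z. \<mu> z * loss_at l f z \<partial>D) = (\<integral>z. min \<gamma> (\<mu> z) * loss_at l f z \<partial>D)" if "f \<in> H" for f
    proof (rule integral_cong_AE)
      show "AE z in D. \<mu> z * loss_at l f z = min \<gamma> (\<mu> z) * loss_at l f z"
        using \<mu>(3) by eventually_elim simp
    qed (use \<mu>m l_meas[OF that] in simp_all)
    then have "dual_fun D0 D H l0 l \<mu> = dual_fun D0 D H l0 l (\<lambda>z. min \<gamma> (\<mu> z))"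
      unfolding dual_eq by (intro INF_cong) auto
    also have "\<dots> \<le> dual_fun D0 D H l0 l \<rho>" using \<mu>(2) \<mu>m gamma by (intro \<rho>_max) auto
    finally show ?thesis .
  qed
  define Ds where "Ds = (SUP \<mu>\<in>L1_plus_bounded D \<gamma>. dual_fun D0 D H l0 l \<mu>)"
  have Ds: "Ds = dual_fun D0 D H l0 l \<rho>"
    unfolding Ds_def using \<rho>_in \<rho>_max' by (intro cSup_eq_maximum) auto
  have Ds_le: "Ds \<le> a f + (\<integral>z. \<rho> z * loss_at l f z \<partial>D)" if "f \<in> H" for f
    unfolding Ds dual_eq using L_bdd[OF \<rho>m \<rho>_range] that by (intro cINF_lower)

  have pop: "\<exists>\<mu>. is_arg_max (dual_fun D0 D H l0 l) (\<lambda>\<mu>. \<mu> \<in> L1_plus_bounded D \<gamma>) \<mu>"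
    using \<rho>_in \<rho>_max' by (intro exI[of _ \<rho>]) (auto simp: is_arg_max_def not_less)

  \<comment> \<open>Attainment of the empirical problem\<close>
  have emp: "\<exists>\<mu>. is_arg_max (emp_dual_fun N (\<lambda>n. S0 n \<omega>) (\<lambda>n. S n \<omega>) H l0 l)
        (\<lambda>\<mu>. \<mu> \<in> {..<N} \<rightarrow>\<^sub>E {0..\<gamma>}) \<mu>" if \<omega>: "\<omega> \<in> space M" for \<omega>
  proof -
    let ?Q = "uniform_count_measure {..<N}"
    interpret Q: prob_space ?Q using N by (intro prob_space_uniform_count_measure) auto
    let ?a = "\<lambda>f. (\<Sum>n<N. loss_at l0 f (S0 n \<omega>)) / real N"
    have a_nn: "0 \<le> ?a f" if "f \<in> H" for f
      using l0_bd[OF that S0_sp[OF _ \<omega>]] by (intro divide_nonneg_nonneg sum_nonneg) auto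
    have meas: "g \<in> borel_measurable ?Q" for g :: "nat \<Rightarrow> real"
      by (simp add: measurable_def space_uniform_count_measure sets_uniform_count_measure)
    have eq: "emp_dual_fun N (\<lambda>n. S0 n \<omega>) (\<lambda>n. S n \<omega>) H l0 l \<nu> =
        (INF f\<in>H. ?a f + (\<integral>n. \<nu> n * loss_at l f (S n \<omega>) \<partial>?Q))" for \<nu>
      by (simp add: emp_dual_fun_def emp_lagrangian_def integral_uniform_count_measure)
    have "\<exists>\<mu>\<in>borel_measurable ?Q. (\<forall>z\<in>space ?Q. \<mu> z \<in> {0..\<gamma>}) \<and>
      (\<forall>\<nu>\<in>borel_measurable ?Q. (\<forall>z\<in>space ?Q. \<nu> z \<in> {0..\<gamma>}) \<longrightarrow>
        emp_dual_fun N (\<lambda>n. S0 n \<omega>) (\<lambda>n. S n \<omega>) H l0 l \<nu> \<le> emp_dual_fun N (\<lambda>n. S0 n \<omega>) (\<lambda>n. S n \<omega>) H l0 l \<mu>)"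
      unfolding eq
      by (rule Q.restricted_dual_attained[where K=K and A=0])
        (use H gamma a_nn meas l_abs S_sp[OF _ \<omega>] in \<open>auto simp: space_uniform_count_measure\<close>)
    then obtain \<mu> where \<mu>: "\<forall>n\<in>{..<N}. \<mu> n \<in> {0..\<gamma>}"
      "\<forall>\<nu>. (\<forall>n\<in>{..<N}. \<nu> n \<in> {0..\<gamma>}) \<longrightarrow>
        emp_dual_fun N (\<lambda>n. S0 n \<omega>) (\<lambda>n. S n \<omega>) H l0 l \<nu> \<le> emp_dual_fun N (\<lambda>n. S0 n \<omega>) (\<lambda>n. S n \<omega>) H l0 l \<mu>"
      unfolding space_uniform_count_measure using meas by blast
    \<comment> \<open>Admissible vectors are extensional; values off \<open>{..<N}\<close> do not
      enter the empirical dual function.\<close>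
    have "emp_dual_fun N (\<lambda>n. S0 n \<omega>) (\<lambda>n. S n \<omega>) H l0 l (restrict \<mu> {..<N}) =
        emp_dual_fun N (\<lambda>n. S0 n \<omega>) (\<lambda>n. S n \<omega>) H l0 l \<mu>"
      by (simp add: emp_dual_fun_def emp_lagrangian_def)
    then show ?thesis
      using \<mu> by (intro exI[of _ "restrict \<mu> {..<N}"]) (auto simp: is_arg_max_def not_less PiE_iff)
  qed

  \<comment> \<open>The high-probability bound\<close>
  have conc: "holds_with_prob M (1 - 4 * \<delta>) (\<lambda>\<omega>. \<forall>\<mu> f.
        is_arg_max (emp_dual_fun N (\<lambda>n. S0 n \<omega>) (\<lambda>n. S n \<omega>) H l0 l)
          (\<lambda>\<mu>. \<mu> \<in> {..<N} \<rightarrow>\<^sub>E {0..\<gamma>}) \<mu> \<longrightarrow>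
        is_arg_min (\<lambda>f. emp_lagrangian N (\<lambda>n. S0 n \<omega>) (\<lambda>n. S n \<omega>) l0 l f \<mu>) (\<lambda>f. f \<in> H) f \<longrightarrow>
        \<bar>Ds - emp_lagrangian N (\<lambda>n. S0 n \<omega>) (\<lambda>n. S n \<omega>) l0 l f \<mu>\<bar>
          \<le> 2 * \<zeta>0 D0 N \<delta> + \<gamma> * \<zeta> D N \<delta>)" if \<delta>: "\<delta> \<in> {0<..<1}" for \<delta>
  proof -
    define e0 where "e0 = \<zeta>0 D0 N \<delta>"
    define e where "e = \<zeta> D N \<delta>"
    have e0: "0 \<le> e0" and e: "0 \<le> e"
      using uniform_conv(1,2) distributions \<delta> samples(2) unfolding uniform_convergence_def e0_def e_def by blast+
    define Ea where "Ea \<omega> f = (\<Sum>n<N. loss_at l0 f (S0 n \<omega>)) / real N" for \<omega> f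
    have emp_lag: "emp_lagrangian N (\<lambda>n. S0 n \<omega>) (\<lambda>n. S n \<omega>) l0 l f \<mu> =
        Ea \<omega> f + (\<Sum>n<N. \<mu> n * loss_at l f (S n \<omega>)) / real N" for \<omega> f \<mu>
      by (simp add: emp_lagrangian_def Ea_def)
    have uc_event: "\<exists>\<Omega>\<in>sets M. 1 - \<delta> \<le> M.prob \<Omega> \<and> (\<forall>\<omega>\<in>\<Omega>. \<forall>f\<in>H.
        \<bar>(\<integral>z. loss_at h f z \<partial>Q) - (\<Sum>n<N. loss_at h f (T n \<omega>)) / real N\<bar> \<le> z Q N \<delta>)"
      if uc: "uniform_convergence (MX \<Otimes>\<^sub>M MY) H h z" and Q: "Q \<in> distributions (MX \<Otimes>\<^sub>M MY)"
        and T: "iid_sample M Q N T" for h z Q T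
    proof -
      have "holds_with_prob (Pi\<^sub>M {..<N} (\<lambda>_. Q)) (1 - \<delta>)
           (\<lambda>s. \<forall>f\<in>H. \<bar>(\<integral>z. loss_at h f z \<partial>Q) - (\<Sum>n<N. loss_at h f (s n)) / real N\<bar> \<le> z Q N \<delta>)"
        using uc Q \<delta> samples(2) unfolding uniform_convergence_def by blast
      then obtain A where A: "A \<in> sets (Pi\<^sub>M {..<N} (\<lambda>_. Q))" "1 - \<delta> \<le> measure (Pi\<^sub>M {..<N} (\<lambda>_. Q)) A"
        "\<And>s. s \<in> A \<Longrightarrow> \<forall>f\<in>H. \<bar>(\<integral>z. loss_at h f z \<partial>Q) - (\<Sum>n<N. loss_at h f (s n)) / real N\<bar> \<le> z Q N \<delta>"
        unfolding holds_with_prob_def by blast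
      show ?thesis
        using iid_sample_event[OF samples(1,2) T A(1)] A(2) A(3)[of "\<lambda>n\<in>{..<N}. T n _"]
        by (intro bexI[of _ "{\<omega> \<in> space M. (\<lambda>n\<in>{..<N}. T n \<omega>) \<in> A}"]) auto
    qed
    obtain \<Omega>0 where \<Omega>0: "\<Omega>0 \<in> sets M" "1 - \<delta> \<le> M.prob \<Omega>0"
      "\<And>\<omega> f. \<omega> \<in> \<Omega>0 \<Longrightarrow> f \<in> H \<Longrightarrow> \<bar>a f - Ea \<omega> f\<bar> \<le> e0"
      using uc_event[OF uniform_conv(1) distributions(1) samples(3)] unfolding a_def Ea_def e0_def by blast
    have sp: "\<omega> \<in> space M" if "\<omega> \<in> \<Omega>0" for \<omega> using sets.sets_into_space[OF \<Omega>0(1)] that by blast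
    have \<rho>S: "(\<lambda>n\<in>{..<N}. \<kappa> (S n \<omega>)) \<in> {..<N} \<rightarrow>\<^sub>E {0..\<gamma>}"
      if "\<omega> \<in> space M" "\<And>z. z \<in> space D \<Longrightarrow> \<kappa> z \<in> {0..\<gamma>}" for \<kappa> \<omega>
      using that S_sp[OF _ that(1)] spD(1) by (auto simp: PiE_iff)
    show ?thesis
    proof (cases "0 < c \<and> c < B")

      \<comment> \<open>Constraint loss of constant sign\<close>
      case False
      \<comment> \<open>For \<open>c \<le> 0\<close> the constraint loss is nonnegative and the
        largest multiplier is best; otherwise \<open>B \<le> c\<close>, the loss is nonpositive and
        the multiplier 0 is best.\<close>
      define k where "k = (if c \<le> 0 then \<gamma> else 0)"
      have k: "0 \<le> k" "k \<le> \<gamma>" using gamma by (auto simp: k_def)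
      have kl: "m * loss_at l f z \<le> k * loss_at l f z"
        if "m \<in> {0..\<gamma>}" "f \<in> H" "z \<in> space MX \<times> space MY" for m f z
      proof (cases "c \<le> 0")
        case True
        then show ?thesis using l_bd[OF that(2,3)] that(1) by (simp add: k_def mult_right_mono)
      next
        case False
        then have "loss_at l f z \<le> 0" using l_bd[OF that(2,3)] \<open>\<not> (0 < c \<and> c < B)\<close> by auto
        then show ?thesis using that(1) False by (simp add: k_def mult_nonneg_nonpos)
      qed
      have Ds_k: "Ds \<le> a f + k * (\<integral>z. loss_at l f z \<partial>D)" if "f \<in> H" for f
      proof -
        have "(\<integral>z. \<rho> z * loss_at l f z \<partial>D) \<le> (\<integral>z. k * loss_at l f z \<partial>D)"
          using kl[OF \<rho>_range that] spD k
          by (intro integral_mono \<nu>l_int[OF \<rho>m \<rho>_range that] \<nu>l_int[OF _ _ that]) auto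
        then show ?thesis using Ds_le[OF that] by simp
      qed
      have k_Ds: "x \<le> Ds" if "\<And>f. f \<in> H \<Longrightarrow> x \<le> a f + k * (\<integral>z. loss_at l f z \<partial>D)" for x
      proof -
        have "x \<le> dual_fun D0 D H l0 l (\<lambda>_. k)" unfolding dual_eq using H that by (intro cINF_greatest) auto
        also have "\<dots> \<le> Ds" unfolding Ds using k by (intro \<rho>_max) auto
        finally show ?thesis .
      qed
      obtain \<Omega>1 where \<Omega>1: "\<Omega>1 \<in> sets M" "1 - \<delta> \<le> M.prob \<Omega>1"
        "\<And>\<omega> f. \<omega> \<in> \<Omega>1 \<Longrightarrow> f \<in> H \<Longrightarrow>
          \<bar>(\<integral>z. loss_at l f z \<partial>D) - (\<Sum>n<N. loss_at l f (S n \<omega>)) / real N\<bar> \<le> e"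
        using uc_event[OF uniform_conv(2) distributions(2) samples(4)] unfolding e_def by blast
      have ke: "k * e \<le> \<gamma> * e" using k e by (intro mult_right_mono)
      have dev: "\<bar>k * (\<integral>z. loss_at l f z \<partial>D) - (\<Sum>n<N. k * loss_at l f (S n \<omega>)) / real N\<bar> \<le> k * e"
        if "\<omega> \<in> \<Omega>1" "f \<in> H" for \<omega> f
      proof -
        have "k * (\<integral>z. loss_at l f z \<partial>D) - (\<Sum>n<N. k * loss_at l f (S n \<omega>)) / real N =
          k * ((\<integral>z. loss_at l f z \<partial>D) - (\<Sum>n<N. loss_at l f (S n \<omega>)) / real N)"
          by (simp add: sum_distrib_left[symmetric] right_diff_distrib)
        then show ?thesis using \<Omega>1(3)[OF that] k by (simp add: abs_mult mult_left_mono)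
      qed
      have main: "\<bar>Ds - emp_lagrangian N (\<lambda>n. S0 n \<omega>) (\<lambda>n. S n \<omega>) l0 l f \<mu>\<bar> \<le> 2 * e0 + \<gamma> * e"
        if \<omega>: "\<omega> \<in> \<Omega>0 \<inter> \<Omega>1"
          and \<mu>: "is_arg_max (emp_dual_fun N (\<lambda>n. S0 n \<omega>) (\<lambda>n. S n \<omega>) H l0 l) (\<lambda>\<mu>. \<mu> \<in> {..<N} \<rightarrow>\<^sub>E {0..\<gamma>}) \<mu>"
          and f: "is_arg_min (\<lambda>f. emp_lagrangian N (\<lambda>n. S0 n \<omega>) (\<lambda>n. S n \<omega>) l0 l f \<mu>) (\<lambda>f. f \<in> H) f"
        for \<omega> \<mu> f
      proof -
        let ?x = "emp_lagrangian N (\<lambda>n. S0 n \<omega>) (\<lambda>n. S n \<omega>) l0 l f \<mu>"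
        note bounds = empirical_value_bounds[OF \<mu> f]
        have \<omega>M: "\<omega> \<in> space M" using sp \<omega> by blast
        have "Ds - e0 - k * e \<le> ?x"
        proof (rule bounds(3))
          show "(\<lambda>n\<in>{..<N}. k) \<in> {..<N} \<rightarrow>\<^sub>E {0..\<gamma>}" using k by auto
          fix f' assume f': "f' \<in> H"
          have "emp_lagrangian N (\<lambda>n. S0 n \<omega>) (\<lambda>n. S n \<omega>) l0 l f' (\<lambda>n\<in>{..<N}. k) =
             Ea \<omega> f' + (\<Sum>n<N. k * loss_at l f' (S n \<omega>)) / real N" by (simp add: emp_lag)
          then show "Ds - e0 - k * e \<le> emp_lagrangian N (\<lambda>n. S0 n \<omega>) (\<lambda>n. S n \<omega>) l0 l f' (\<lambda>n\<in>{..<N}. k)"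
            using Ds_k[OF f'] \<Omega>0(3)[of \<omega> f'] dev[of \<omega> f'] \<omega> f' by (auto simp: abs_le_iff)
        qed
        moreover have "?x - e0 - k * e \<le> Ds"
        proof (rule k_Ds)
          fix f' assume f': "f' \<in> H"
          have "(\<Sum>n<N. \<mu> n * loss_at l f' (S n \<omega>)) / real N \<le> (\<Sum>n<N. k * loss_at l f' (S n \<omega>)) / real N"
            using bounds(1) S_sp[OF _ \<omega>M] f'
            by (intro divide_right_mono sum_mono kl) (auto simp: PiE_iff)
          then show "?x - e0 - k * e \<le> a f' + k * (\<integral>z. loss_at l f' z \<partial>D)"
            using bounds(2)[OF f'] \<Omega>0(3)[of \<omega> f'] dev[of \<omega> f'] \<omega> f'
            unfolding emp_lag[of \<omega> f'] by (auto simp: abs_le_iff)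
        qed
        ultimately show ?thesis using ke e0 by (simp add: abs_le_iff)
      qed
      have "1 - (\<delta> + \<delta>) \<le> M.prob (\<Omega>0 \<inter> \<Omega>1)" using \<Omega>0 \<Omega>1 by (intro M.prob_Int_ge)
      then have "1 - 4 * \<delta> \<le> M.prob (\<Omega>0 \<inter> \<Omega>1)" using \<delta> by simp
      then show ?thesis
        unfolding holds_with_prob_def e0_def[symmetric] e_def[symmetric]
        using \<Omega>0(1) \<Omega>1(1) main sp by (intro bexI[of _ "\<Omega>0 \<inter> \<Omega>1"]) auto
    next

      \<comment> \<open>Threshold strictly between 0 and \<open>B\<close>\<close>
      case True
      let ?P = "Pi\<^sub>M {..<N} (\<lambda>_. D)"
      \<comment> \<open>The confidence term of both rates; with differences \<open>B / N\<close> per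
        coordinate, a one-sided tail at \<open>t\<close> has mass at most
        \<open>\<delta> / 2\<close>.\<close>
      define t where "t = B * sqrt (ln (2 / \<delta>) / (2 * real N))"
      have B: "0 < B" using True by simp
      have ln: "0 < ln (2 / \<delta>)" using \<delta> by simp
      then have t: "0 < t" using B N by (simp add: t_def)
      have t2: "2 * real N * t\<^sup>2 / B\<^sup>2 = ln (2 / \<delta>)"
        using ln B N by (simp add: t_def power_mult_distrib)
      have tail: "exp (- (2 * real N * t\<^sup>2 / B\<^sup>2)) = \<delta> / 2"
        unfolding t2 using \<delta> by (simp add: exp_minus)
      have "0 \<le> rademacher_complexity D0 H l0 N"
        using l0_bd by (intro rademacher_complexity_nonneg[OF H, of _ _ B]) (auto simp: spD)
      moreover have "e0 = 2 * rademacher_complexity D0 H l0 N + t"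
        using rademacher_rates(1) samples(2) \<delta> by (simp add: vanishing_rademacher_rate_def e0_def t_def)
      \<comment> \<open>Positivity leaves room for the two slacks \<open>e0 / 2\<close> in the
        choice of the mixture.\<close>
      ultimately have e0_pos: "0 < e0" using t by simp
      define R where "R = rademacher_complexity D H l N"
      have R: "0 \<le> R"
        unfolding R_def using l_abs by (intro rademacher_complexity_nonneg[OF H, of _ _ K]) (auto simp: spD)
      have e_eq: "e = 2 * R + t"
        using rademacher_rates(2) samples(2) \<delta> by (simp add: vanishing_rademacher_rate_def e_def R_def t_def)

      \<comment> \<open>For \<open>\<gamma> = 0\<close> division by zero gives the weight 0, which
        is consistent because \<rho> then vanishes as well.\<close>
      define w where "w z = \<rho> z / \<gamma>" for z
      have w01: "w z \<in> {0..1}" if "z \<in> space D" for z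
        using \<rho>_range[OF that] gamma by (auto simp: w_def divide_le_eq_1)
      have \<rho>w: "\<rho> z = \<gamma> * w z" if "z \<in> space D" for z
        using \<rho>_range[OF that] by (auto simp: w_def)
      have "\<exists>A\<in>sets ?P. 1 - exp (- 2 * real N * t\<^sup>2 / ((B - c) - (- c))\<^sup>2) \<le> measure ?P A \<and>
        (\<forall>s\<in>A. \<forall>f\<in>H. (\<integral>z. w z * loss_at l f z \<partial>D) - (\<Sum>n<N. w (s n) * loss_at l f (s n)) / real N \<le> 2 * R + t)"
        unfolding R_def rademacher_complexity_eq_sum(2)[OF rademacher_meaningful(2) samples(2)]
      proof (rule weighted_uniform_deviation)
        show "w \<in> borel_measurable D" unfolding w_def by measurable
        show "integrable (completion ?P) (\<lambda>s. SUP f\<in>H. \<Sum>n<N. \<sigma> n * loss_at l f (s n))"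
          if "\<sigma> \<in> PiE_dflt {..<N} 0 (\<lambda>_. {- 1, 1})" for \<sigma>
          using rademacher_complexity_eq_sum(1)[OF rademacher_meaningful(2) samples(2) that] .
        show "loss_at l f z \<in> {- c..B - c}" if "f \<in> H" "z \<in> space D" for f z
          using l_bd that by (simp add: spD)
      qed (use D.prob_space_axioms N H l_meas True w01 t in auto)
      then obtain A1 where A1: "A1 \<in> sets ?P" "1 - \<delta> / 2 \<le> measure ?P A1"
        "\<And>s f. s \<in> A1 \<Longrightarrow> f \<in> H \<Longrightarrow>
          (\<integral>z. w z * loss_at l f z \<partial>D) - (\<Sum>n<N. w (s n) * loss_at l f (s n)) / real N \<le> e"
        using tail by (auto simp: e_eq)

      obtain F p where F: "finite F" "F \<subseteq> H" "\<And>f. f \<in> F \<Longrightarrow> 0 \<le> p f" "sum p F = 1"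
        and Fp: "(\<Sum>f\<in>F. p f * a f) + \<gamma> * (\<integral>z. max 0 (\<Sum>f\<in>F. p f * loss_at l f z) \<partial>D) \<le> Ds + e0"
      proof -
        \<comment> \<open>The first \<open>e0 / 2\<close> makes the dual bound strict, as
          \<open>saddle_mixture\<close> requires; the second is its accuracy.\<close>
        have "\<exists>F p. finite F \<and> F \<subseteq> H \<and> (\<forall>i\<in>F. 0 \<le> p i) \<and> sum p F = 1 \<and>
          (\<Sum>i\<in>F. p i * a i) + \<gamma> * (\<integral>z. max 0 (\<Sum>i\<in>F. p i * loss_at l i z) \<partial>D) \<le> (Ds + e0 / 2) + e0 / 2"
        proof (rule D.saddle_mixture[where A=0 and K=K])
          fix \<nu> assume \<nu>: "\<nu> \<in> borel_measurable D" "\<And>z. z \<in> space D \<Longrightarrow> \<nu> z \<in> {0..\<gamma>}"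
          have "dual_fun D0 D H l0 l \<nu> < Ds + e0 / 2" using \<rho>_max[OF \<nu>] e0_pos by (simp add: Ds)
          then show "\<exists>i\<in>H. a i + (\<integral>z. \<nu> z * loss_at l i z \<partial>D) < Ds + e0 / 2"
            unfolding dual_eq using cINF_less_iff[OF H L_bdd[OF \<nu>]] by auto
        qed (use l_meas l_abs a0 gamma e0_pos spD in auto)
        then obtain F p where *: "finite F" "F \<subseteq> H" "\<forall>i\<in>F. 0 \<le> p i" "sum p F = 1"
          "(\<Sum>i\<in>F. p i * a i) + \<gamma> * (\<integral>z. max 0 (\<Sum>i\<in>F. p i * loss_at l i z) \<partial>D) \<le> (Ds + e0 / 2) + e0 / 2"
          by blast
        show thesis by (rule that[OF *(1,2) _ *(4)]) (use *(3,5) in auto)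
      qed
      define u where "u z = (\<Sum>f\<in>F. p f * loss_at l f z)" for z
      have um[measurable]: "u \<in> borel_measurable D"
        unfolding u_def using l_meas F(2) by (intro borel_measurable_sum borel_measurable_times) auto
      have u_le: "u z \<le> B - c" if "z \<in> space D" for z
      proof -
        have "u z \<le> (\<Sum>f\<in>F. p f * (B - c))"
          unfolding u_def using F(2,3) l_bd that spD by (intro sum_mono mult_left_mono) auto
        also have "\<dots> = B - c" using F(4) by (simp add: sum_distrib_right[symmetric])
        finally show ?thesis .
      qed
      \<comment> \<open>The mixed loss is at most \<open>B - c\<close>, which is below
        \<open>B\<close> because \<open>0 < c\<close>; the positive part thus has range
        \<open>B\<close>, matching \<open>t\<close>.\<close>
      have up: "max 0 (u z) \<in> {0..B}" if "z \<in> space D" for z using u_le[OF that] True by auto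
      \<comment> \<open>\<open>\<gamma> * U\<close> bounds the constraint term of the mixture for
        every multiplier in \<open>[0, \<gamma>]^N\<close>, including one chosen from the
        sample.\<close>
      define U where "U s = (\<Sum>n<N. max 0 (u (s n))) / real N" for s
      interpret P: product_prob_space "\<lambda>_. D" "{..<N}" by unfold_locales
      have s_sp: "s n \<in> space D" if "s \<in> space ?P" "n < N" for s n
        using that by (auto simp: space_PiM PiE_iff)
      have comp[measurable]: "(\<lambda>s. s n) \<in> ?P \<rightarrow>\<^sub>M D" if "n < N" for n
        using that by (intro measurable_component_singleton) auto
      have Um[measurable]: "U \<in> borel_measurable ?P" unfolding U_def[abs_def] by measurable
      have EU: "(\<integral>s. U s \<partial>?P) = (\<integral>z. max 0 (u z) \<partial>D)"
      proof -
        have 1: "integrable ?P (\<lambda>s. max 0 (u (s n)))" "(\<integral>s. max 0 (u (s n)) \<partial>?P) = (\<integral>z. max 0 (u z) \<partial>D)"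
          if "n < N" for n
        proof -
          have d: "distr ?P D (\<lambda>s. s n) = D" using P.PiM_component[of n] that by simp
          show "integrable ?P (\<lambda>s. max 0 (u (s n)))"
            using up[OF s_sp[OF _ that]] comp[OF that]
            by (intro P.P.integrable_const_bound[of _ B] AE_I2) auto
          show "(\<integral>s. max 0 (u (s n)) \<partial>?P) = (\<integral>z. max 0 (u z) \<partial>D)"
            using integral_distr[OF comp[OF that], of "\<lambda>z. max 0 (u z)"] unfolding d by simp
        qed
        show ?thesis unfolding U_def using 1 N by (simp add: Bochner_Integration.integral_sum)
      qed
      have U_range: "U s \<in> {0..B}" if "s \<in> space ?P" for s
      proof -
        have "(\<Sum>n<N. max 0 (u (s n))) \<le> (\<Sum>n<N. B)" using up[OF s_sp[OF that]] by (intro sum_mono) auto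
        moreover have "0 \<le> (\<Sum>n<N. max 0 (u (s n)))" by (intro sum_nonneg) auto
        ultimately show ?thesis using N by (simp add: U_def field_simps)
      qed
      have U_diff: "AE s in ?P. U s \<le> U (s(n := z)) + B / real N" if n: "n < N" and z: "z \<in> space D" for n z
      proof (rule AE_I2)
        fix s assume s: "s \<in> space ?P"
        have "(\<Sum>k<N. max 0 (u (s k))) - (\<Sum>k<N. max 0 (u ((s(n := z)) k))) =
            (\<Sum>k<N. if k = n then max 0 (u (s n)) - max 0 (u z) else 0)"
          unfolding sum_subtractf[symmetric] by (intro sum.cong) auto
        also have "\<dots> = max 0 (u (s n)) - max 0 (u z)" using n by simp
        also have "\<dots> \<le> B" using up[OF z] up[OF s_sp[OF s n]] by auto
        finally have "U s - U (s(n := z)) \<le> B / real N"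
          unfolding U_def diff_divide_distrib[symmetric] by (intro divide_right_mono) auto
        then show "U s \<le> U (s(n := z)) + B / real N" by simp
      qed
      define A2 where "A2 = {s \<in> space ?P. U s \<le> (\<integral>z. max 0 (u z) \<partial>D) + t}"
      have A2: "A2 \<in> sets ?P" unfolding A2_def by measurable
      have "1 - exp (- 2 * t\<^sup>2 / (real N * (B / real N)\<^sup>2)) \<le> measure ?P A2"
        unfolding A2_def
      proof (rule bounded_differences_tail[OF D.prob_space_axioms N _ t Um _ U_diff])
        show "0 < B / real N" using B N by simp
        show "\<bar>U s\<bar> \<le> B" if "s \<in> space ?P" for s using U_range[OF that] by simp
        show "(\<integral>s. U s \<partial>?P) \<le> (\<integral>z. max 0 (u z) \<partial>D)" by (simp add: EU)
      qed
      also have "real N * (B / real N)\<^sup>2 = B\<^sup>2 / real N" using N by (simp add: power2_eq_square)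
      also have "- 2 * t\<^sup>2 / (B\<^sup>2 / real N) = - (2 * real N * t\<^sup>2 / B\<^sup>2)" by simp
      finally have A2_prob: "1 - \<delta> / 2 \<le> measure ?P A2" unfolding tail .

      define \<Omega>1 where "\<Omega>1 = {\<omega> \<in> space M. (\<lambda>n\<in>{..<N}. S n \<omega>) \<in> A1}"
      define \<Omega>2 where "\<Omega>2 = {\<omega> \<in> space M. (\<lambda>n\<in>{..<N}. S n \<omega>) \<in> A2}"
      have \<Omega>1: "\<Omega>1 \<in> sets M" "1 - \<delta> / 2 \<le> M.prob \<Omega>1"
        using iid_sample_event[OF samples(1,2,4) A1(1)] A1(2) by (auto simp: \<Omega>1_def)
      have \<Omega>2: "\<Omega>2 \<in> sets M" "1 - \<delta> / 2 \<le> M.prob \<Omega>2"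
        using iid_sample_event[OF samples(1,2,4) A2] A2_prob by (auto simp: \<Omega>2_def)
      have lower: "(\<integral>z. \<rho> z * loss_at l f z \<partial>D) - (\<Sum>n<N. \<rho> (S n \<omega>) * loss_at l f (S n \<omega>)) / real N \<le> \<gamma> * e"
        if "\<omega> \<in> \<Omega>1" "f \<in> H" for \<omega> f
      proof -
        have \<omega>: "\<omega> \<in> space M" "(\<lambda>n\<in>{..<N}. S n \<omega>) \<in> A1" using that by (auto simp: \<Omega>1_def)
        have S_in: "S n \<omega> \<in> space D" if "n < N" for n using S_sp[OF that \<omega>(1)] by (simp add: spD)
        have "(\<integral>z. w z * loss_at l f z \<partial>D) - (\<Sum>n<N. w (S n \<omega>) * loss_at l f (S n \<omega>)) / real N \<le> e"
          using A1(3)[OF \<omega>(2) that(2)] by simp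
        from mult_left_mono[OF this gamma]
        have "\<gamma> * (\<integral>z. w z * loss_at l f z \<partial>D) - \<gamma> * ((\<Sum>n<N. w (S n \<omega>) * loss_at l f (S n \<omega>)) / real N) \<le> \<gamma> * e"
          by (simp add: right_diff_distrib)
        moreover have "\<gamma> * (\<integral>z. w z * loss_at l f z \<partial>D) = (\<integral>z. \<rho> z * loss_at l f z \<partial>D)"
          unfolding integral_mult_right_zero[symmetric]
          by (intro Bochner_Integration.integral_cong) (auto simp: \<rho>w)
        moreover have "\<gamma> * ((\<Sum>n<N. w (S n \<omega>) * loss_at l f (S n \<omega>)) / real N) =
            (\<Sum>n<N. \<rho> (S n \<omega>) * loss_at l f (S n \<omega>)) / real N"
          by (simp add: sum_distrib_left \<rho>w S_in mult.assoc)
        ultimately show ?thesis by argo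
      qed
      have upper: "(\<Sum>n<N. max 0 (u (S n \<omega>))) / real N \<le> (\<integral>z. max 0 (u z) \<partial>D) + e"
        if "\<omega> \<in> \<Omega>2" for \<omega>
      proof -
        have "U (\<lambda>n\<in>{..<N}. S n \<omega>) \<le> (\<integral>z. max 0 (u z) \<partial>D) + t" using that by (auto simp: \<Omega>2_def A2_def)
        then show ?thesis using R by (simp add: U_def e_eq)
      qed
      have main: "\<bar>Ds - emp_lagrangian N (\<lambda>n. S0 n \<omega>) (\<lambda>n. S n \<omega>) l0 l f \<mu>\<bar> \<le> 2 * e0 + \<gamma> * e"
        if \<omega>: "\<omega> \<in> \<Omega>0 \<inter> (\<Omega>1 \<inter> \<Omega>2)"
          and \<mu>: "is_arg_max (emp_dual_fun N (\<lambda>n. S0 n \<omega>) (\<lambda>n. S n \<omega>) H l0 l) (\<lambda>\<mu>. \<mu> \<in> {..<N} \<rightarrow>\<^sub>E {0..\<gamma>}) \<mu>"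
          and f: "is_arg_min (\<lambda>f. emp_lagrangian N (\<lambda>n. S0 n \<omega>) (\<lambda>n. S n \<omega>) l0 l f \<mu>) (\<lambda>f. f \<in> H) f"
        for \<omega> \<mu> f
      proof -
        let ?x = "emp_lagrangian N (\<lambda>n. S0 n \<omega>) (\<lambda>n. S n \<omega>) l0 l f \<mu>"
        note bounds = empirical_value_bounds[OF \<mu> f]
        have \<omega>M: "\<omega> \<in> space M" using sp \<omega> by blast
        have "Ds - e0 - \<gamma> * e \<le> ?x"
        proof (rule bounds(3)[OF \<rho>S[OF \<omega>M \<rho>_range]])
          fix f' assume f': "f' \<in> H"
          have eq: "emp_lagrangian N (\<lambda>n. S0 n \<omega>) (\<lambda>n. S n \<omega>) l0 l f' (\<lambda>n\<in>{..<N}. \<rho> (S n \<omega>)) =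
             Ea \<omega> f' + (\<Sum>n<N. \<rho> (S n \<omega>) * loss_at l f' (S n \<omega>)) / real N" by (simp add: emp_lag)
          have "\<bar>a f' - Ea \<omega> f'\<bar> \<le> e0" using \<Omega>0(3)[of \<omega> f'] \<omega> f' by blast
          moreover have "(\<integral>z. \<rho> z * loss_at l f' z \<partial>D) - (\<Sum>n<N. \<rho> (S n \<omega>) * loss_at l f' (S n \<omega>)) / real N \<le> \<gamma> * e"
            using lower[of \<omega> f'] \<omega> f' by blast
          ultimately show "Ds - e0 - \<gamma> * e \<le> emp_lagrangian N (\<lambda>n. S0 n \<omega>) (\<lambda>n. S n \<omega>) l0 l f' (\<lambda>n\<in>{..<N}. \<rho> (S n \<omega>))"
            unfolding eq using Ds_le[OF f'] by linarith
        qed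
        moreover have "?x \<le> Ds + 2 * e0 + \<gamma> * e"
        proof -
          \<comment> \<open>A minimum over \<open>H\<close> is at most any average over
            \<open>H\<close>, so randomization costs nothing on the empirical side.\<close>
          have "?x = (\<Sum>f'\<in>F. p f' * ?x)" using F(4) by (simp add: sum_distrib_right[symmetric])
          also have "\<dots> \<le> (\<Sum>f'\<in>F. p f' * emp_lagrangian N (\<lambda>n. S0 n \<omega>) (\<lambda>n. S n \<omega>) l0 l f' \<mu>)"
            using F(2,3) bounds(2) by (intro sum_mono mult_left_mono) auto
          also have "\<dots> = (\<Sum>f'\<in>F. p f' * Ea \<omega> f') + (\<Sum>n<N. \<mu> n * u (S n \<omega>)) / real N"
          proof -
            have "(\<Sum>f'\<in>F. p f' * (\<Sum>n<N. \<mu> n * loss_at l f' (S n \<omega>))) = (\<Sum>n<N. \<mu> n * u (S n \<omega>))"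
              unfolding u_def sum_distrib_left by (subst sum.swap) (simp add: mult_ac)
            then show ?thesis
              by (simp add: emp_lag distrib_left sum.distrib sum_divide_distrib[symmetric])
          qed
          also have "(\<Sum>f'\<in>F. p f' * Ea \<omega> f') \<le> (\<Sum>f'\<in>F. p f' * (a f' + e0))"
          proof (intro sum_mono mult_left_mono F(3))
            fix f' assume "f' \<in> F"
            then have "\<bar>a f' - Ea \<omega> f'\<bar> \<le> e0" using \<Omega>0(3)[of \<omega> f'] \<omega> F(2) by blast
            then show "Ea \<omega> f' \<le> a f' + e0" by linarith
          qed
          also have "(\<Sum>f'\<in>F. p f' * (a f' + e0)) = (\<Sum>f'\<in>F. p f' * a f') + e0"
            using F(4) by (simp add: distrib_left sum.distrib sum_distrib_right[symmetric])
          also have "(\<Sum>n<N. \<mu> n * u (S n \<omega>)) / real N \<le> (\<Sum>n<N. \<gamma> * max 0 (u (S n \<omega>))) / real N"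
          proof (intro divide_right_mono sum_mono)
            fix n assume "n \<in> {..<N}"
            then have \<mu>n: "0 \<le> \<mu> n" "\<mu> n \<le> \<gamma>" using bounds(1) by (auto simp: PiE_iff)
            have "\<mu> n * u (S n \<omega>) \<le> \<mu> n * max 0 (u (S n \<omega>))" using \<mu>n by (intro mult_left_mono) auto
            also have "\<dots> \<le> \<gamma> * max 0 (u (S n \<omega>))" using \<mu>n by (intro mult_right_mono) auto
            finally show "\<mu> n * u (S n \<omega>) \<le> \<gamma> * max 0 (u (S n \<omega>))" .
          qed auto
          also have "\<dots> = \<gamma> * ((\<Sum>n<N. max 0 (u (S n \<omega>))) / real N)" by (simp add: sum_distrib_left)
          also have "\<dots> \<le> \<gamma> * ((\<integral>z. max 0 (u z) \<partial>D) + e)" using upper[of \<omega>] \<omega> gamma by (intro mult_left_mono) auto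
          finally have "?x \<le> (\<Sum>f'\<in>F. p f' * a f') + e0 + \<gamma> * ((\<integral>z. max 0 (u z) \<partial>D) + e)" by simp
          then show ?thesis using Fp[folded u_def] by (simp add: distrib_left)
        qed
        ultimately show ?thesis using e0 by (simp add: abs_le_iff)
      qed
      \<comment> \<open>One \<delta> for \<open>l0\<close> and two halves for the one-sided bounds
        on the constraint term: \<open>2 * \<delta>\<close> in total, within the allowed
        \<open>4 * \<delta>\<close>.\<close>
      have "1 - (\<delta> + (\<delta> / 2 + \<delta> / 2)) \<le> M.prob (\<Omega>0 \<inter> (\<Omega>1 \<inter> \<Omega>2))"
        using \<Omega>0 \<Omega>1 \<Omega>2 by (intro M.prob_Int_ge) auto
      then have "1 - 4 * \<delta> \<le> M.prob (\<Omega>0 \<inter> (\<Omega>1 \<inter> \<Omega>2))" using \<delta> by simp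
      then show ?thesis
        unfolding holds_with_prob_def e0_def[symmetric] e_def[symmetric]
        using \<Omega>0(1) \<Omega>1(1) \<Omega>2(1) main sp by (intro bexI[of _ "\<Omega>0 \<inter> (\<Omega>1 \<inter> \<Omega>2)"]) auto
    qed
  qed
  show ?thesis using pop emp conc unfolding Ds_def by blast
qed

end
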